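(* Let $M$ be a torus with one boundary component, so that $\pi_1(M)$ is the free group on two generators $X,Y$ and the boundary loop is $K=XYX^{-1}Y^{-1}$. Let $\sigma\in\operatorname{Hom}(\pi_1(M),\mathrm{SU}(2))$ be such that $\sigma(\pi_1(M))$ is dense in $\mathrm{SU}(2)$, and let $k=\operatorname{tr}(\sigma(K))$. Then the $\Gamma$-orbit of the conjugacy class $[\sigma]$ is dense in $E_k$.
   Context: $E=\operatorname{Hom}(\pi_1(M),\mathrm{SU}(2))/\mathrm{SU}(2)$, with $\mathrm{SU}(2)$ acting by conjugation; $[\sigma]$ denotes the class of $\sigma$. The map $[\sigma]\mapsto(x,y,z)=(\operatorname{tr}\sigma(X),\operatorname{tr}\sigma(Y),\operatorname{tr}\sigma(XY))$ ("global coordinates") is injective. One has $\operatorname{tr}\sigma(K)=x^2+y^2+z^2-xyz-2$, and the image of $E$ is $\{(x,y,z)\in[-2,2]^3:-2\le x^2+y^2+z^2-xyz-2\le 2\}$; $E$ is identified with this set and carries the subspace topology from $\mathbb{R}^3$. For $k\in[-2,2]$, $E_k=\{[\sigma]\in E:\operatorname{tr}\sigma(K)=k\}$ (the relative character variety for the conjugacy class of trace $k$). $\Gamma$ is the mapping class group $\pi_0(\mathrm{Diff}(M,\partial M))$. It is generated by Dehn twists $\tau_X,\tau_Y$ (acting on $\pi_1$ by $\tau_X(X)=X,\ \tau_X(Y)=YX$ and $\tau_Y(X)=XY,\ \tau_Y(Y)=Y$), which act on $E$ in global coordinates by $\tau_X(x,y,z)=(x,z,xz-y)$ and $\tau_Y(x,y,z)=(z,y,yz-x)$;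 these preserve each $E_k$. *)

theory Defs
  imports "HOL-Analysis.Analysis"
begin

type_synonym cmat2 = "complex^2^2"

definition ctrans :: "cmat2 \<Rightarrow> cmat2" where
  "ctrans A = (\<chi> i j. cnj (A $ j $ i))"

definition SU2 :: "cmat2 set" where
  "SU2 = {A. A ** ctrans A = mat 1 \<and> det A = 1}"

text \<open>The image of the homomorphism sigma from the free group on X, Y with
  sigma(X) = A, sigma(Y) = B: the subgroup of SU(2) generated by A and B
  (for elements of SU(2) the inverse is the conjugate transpose).\<close>
inductive_set gen_subgroup :: "cmat2 \<Rightarrow> cmat2 \<Rightarrow> cmat2 set" for A B where
  one: "mat 1 \<in> gen_subgroup A B"
| genA: "A \<in> gen_subgroup A B"
| genB: "B \<in> gen_subgroup A B"
| mult: "C \<in> gen_subgroup A B \<Longrightarrow> D \<in> gen_subgroup A B \<Longrightarrow> C ** D \<in> gen_subgroup A B"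
| inv: "C \<in> gen_subgroup A B \<Longrightarrow> ctrans C \<in> gen_subgroup A B"

text \<open>Global coordinates (tr sigma(X), tr sigma(Y), tr sigma(XY)) of [sigma];
  traces of SU(2) matrices are real.\<close>
definition global_coords :: "cmat2 \<Rightarrow> cmat2 \<Rightarrow> real \<times> real \<times> real" where
  "global_coords A B = (Re (trace A), Re (trace B), Re (trace (A ** B)))"

text \<open>tr sigma(K) in global coordinates.\<close>
definition kappa :: "real \<times> real \<times> real \<Rightarrow> real" where
  "kappa p = (case p of (x, y, z) \<Rightarrow> x^2 + y^2 + z^2 - x*y*z - 2)"

text \<open>E identified with its image in R^3, and the relative character variety E_k.\<close>
definition Echar :: "(real \<times> real \<times> real) set" where
  "Echar = {(x, y, z). x \<in> {-2..2} \<and> y \<in> {-2..2} \<and> z \<in> {-2..2}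
                     \<and> -2 \<le> kappa (x, y, z) \<and> kappa (x, y, z) \<le> 2}"

definition Erel :: "real \<Rightarrow> (real \<times> real \<times> real) set" where
  "Erel k = {p \<in> Echar. kappa p = k}"

text \<open>Action of the Dehn twists in global coordinates.\<close>
definition tauX :: "real \<times> real \<times> real \<Rightarrow> real \<times> real \<times> real" where
  "tauX p = (case p of (x, y, z) \<Rightarrow> (x, z, x*z - y))"

definition tauY :: "real \<times> real \<times> real \<Rightarrow> real \<times> real \<times> real" where
  "tauY p = (case p of (x, y, z) \<Rightarrow> (z, y, y*z - x))"

definition tauX_inv :: "real \<times> real \<times> real \<Rightarrow> real \<times> real \<times> real" where
  "tauX_inv p = (case p of (x, y, z) \<Rightarrow> (x, x*y - z, y))"

definition tauY_inv :: "real \<times> real \<times> real \<Rightarrow> real \<times> real \<times> real" where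
  "tauY_inv p = (case p of (x, y, z) \<Rightarrow> (y*x - z, y, x))"

text \<open>The orbit of a point under the mapping class group Gamma, generated by tauX, tauY.\<close>
inductive_set Gamma_orbit :: "real \<times> real \<times> real \<Rightarrow> (real \<times> real \<times> real) set" for p where
  base: "p \<in> Gamma_orbit p"
| tX: "q \<in> Gamma_orbit p \<Longrightarrow> tauX q \<in> Gamma_orbit p"
| tY: "q \<in> Gamma_orbit p \<Longrightarrow> tauY q \<in> Gamma_orbit p"
| tXi: "q \<in> Gamma_orbit p \<Longrightarrow> tauX_inv q \<in> Gamma_orbit p"
| tYi: "q \<in> Gamma_orbit p \<Longrightarrow> tauY_inv q \<in> Gamma_orbit p"

end

theory Submission
  imports Defs
begin

text \<open>
  On the level set of \<open>x = 2 cos \<theta>\<close> in \<open>Erel k\<close>, an ellipse, the twist \<open>tauX\<close> is conjugate to the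
  rotation by \<open>\<theta>\<close>. If some point of the orbit has a coordinate \<open>2 cos \<theta>\<close> with \<open>\<theta> / \<pi>\<close> irrational,
  the closure of the orbit therefore contains a whole ellipse by Kronecker's theorem; this ellipse meets
  further irrational ellipses, and these fill a dense subset of \<open>Erel k\<close>.

  Otherwise all coordinates of the orbit have the form \<open>2 cos (2 \<pi> m / n)\<close> and lie in \<open>\<int>[\<zeta>]\<close> for
  one root of unity \<open>\<zeta>\<close>. Such numbers stay in \<open>[-2, 2]\<close> under all Galois conjugations of \<open>\<zeta>\<close>, and only
  finitely many elements of \<open>\<int>[\<zeta>]\<close> do so; hence the orbit and its conjugates are finite. A finite orbit in
  \<open>[-2, 2]\<^sup>3\<close> has \<open>kappa \<le> 2\<close>, so each conjugate of the orbit comes from a pair in \<open>SU(2)\<close>. Hence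
  all conjugates of the traces of the elements of the group are in \<open>[-2, 2]\<close>, so that there are only
  finitely many such traces and the group is not dense.
\<close>

section \<open>Integer polynomials and conjugates of a root of unity\<close>

definition int_poly :: "complex poly \<Rightarrow> bool" where
  "int_poly p \<longleftrightarrow> (\<forall>i. coeff p i \<in> \<int>)"

lemma int_poly_0 [simp]: "int_poly 0"
  and int_poly_1 [simp]: "int_poly 1"
  by (simp_all add: int_poly_def one_pCons coeff_pCons split: nat.split)

lemma int_poly_pCons: "c \<in> \<int> \<Longrightarrow> int_poly p \<Longrightarrow> int_poly (pCons c p)"
  by (simp add: int_poly_def coeff_pCons split: nat.split)

lemma int_poly_const: "c \<in> \<int> \<Longrightarrow> int_poly [:c:]"
  by (simp add: int_poly_pCons)

lemma int_poly_monom: "c \<in> \<int> \<Longrightarrow> int_poly (monom c n)"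
  by (simp add: int_poly_def)

lemma int_poly_smult: "c \<in> \<int> \<Longrightarrow> int_poly p \<Longrightarrow> int_poly (smult c p)"
  by (simp add: int_poly_def)

lemma int_poly_add: "int_poly p \<Longrightarrow> int_poly q \<Longrightarrow> int_poly (p + q)"
  and int_poly_diff: "int_poly p \<Longrightarrow> int_poly q \<Longrightarrow> int_poly (p - q)"
  by (simp_all add: int_poly_def)

lemma int_poly_mult: "int_poly p \<Longrightarrow> int_poly q \<Longrightarrow> int_poly (p * q)"
  unfolding int_poly_def coeff_mult by (intro allI Ints_sum Ints_mult) auto

lemma int_poly_sum: "(\<And>i. i \<in> S \<Longrightarrow> int_poly (g i)) \<Longrightarrow> int_poly (\<Sum>i\<in>S. g i)"
  by (induction S rule: infinite_finite_induct) (auto intro: int_poly_add)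

text \<open>For algebraic \<open>z\<close> these are the Galois conjugates over the rationals, since
  clearing denominators makes integer coefficients sufficient. Field automorphisms are replaced by
  the transfer of polynomial identities from \<open>z\<close> to \<open>w\<close>.\<close>

definition conjugates :: "complex \<Rightarrow> complex set" where
  "conjugates z = {w. \<forall>p. int_poly p \<longrightarrow> poly p z = 0 \<longrightarrow> poly p w = 0}"

lemma self_conjugate [simp]: "z \<in> conjugates z"
  by (simp add: conjugates_def)

lemma conjugates_eqI:
  assumes "w \<in> conjugates z" "int_poly p" "int_poly q" "poly p z = poly q z"
  shows "poly p w = poly q w"
proof -
  have "int_poly (p - q)" "poly (p - q) z = 0" using assms by (auto intro: int_poly_diff)
  then have "poly (p - q) w = 0" using assms(1) unfolding conjugates_def by blast
  then show ?thesis by simp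
qed

lemma conjugates_unity:
  assumes "z ^ N = 1" "w \<in> conjugates z"
  shows "w ^ N = 1"
  using conjugates_eqI[of w z "monom 1 N" 1] assms
  by (simp add: int_poly_monom poly_monom)

section \<open>Pseudo-division and the minimal polynomial\<close>

lemma root_of_dvd: "f dvd p \<Longrightarrow> poly f z = 0 \<Longrightarrow> poly p z = 0"
  for f :: "complex poly"
  by (auto elim!: dvdE)

text \<open>\<open>f\<close> need not be monic, so each further degree costs one more factor of the
  leading coefficient to keep the remainder integral. In the induction step the remainder is
  multiplied by \<open>l\<close> times the variable, and its new coefficient of degree
  \<open>n\<close> is cancelled by a multiple of \<open>f\<close>.\<close>

lemma pseudo_reduce_monom:
  assumes f: "int_poly f" "degree f = n" "n > 0"
  shows "\<exists>r. int_poly r \<and> degree r < n \<and> f dvd (smult (lead_coeff f ^ m) (monom 1 m) - r)"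
proof (induction m)
  case 0
  have "int_poly (1 :: complex poly)" "degree (1 :: complex poly) < n" using f by auto
  moreover have "smult (lead_coeff f ^ 0) (monom 1 0) - 1 = (0 :: complex poly)"
    by (simp add: monom_0 one_pCons)
  ultimately show ?case by (metis dvd_0_right)
next
  case (Suc m)
  then obtain r where r: "int_poly r" "degree r < n" "f dvd (smult (lead_coeff f ^ m) (monom 1 m) - r)"
    by blast
  define l where "l = lead_coeff f"
  define r' where "r' = smult l (pCons 0 r) - smult (coeff (pCons 0 r) n) f"
  have l: "l \<in> \<int>" using f by (auto simp: l_def int_poly_def)
  have "coeff (pCons 0 r) n \<in> \<int>" using r(1) int_poly_pCons[of 0 r] by (auto simp: int_poly_def)
  then have 1: "int_poly r'" unfolding r'_def
    using f r l by (intro int_poly_diff int_poly_smult int_poly_pCons) auto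
  have "degree (pCons 0 r) \<le> n" using r(2) by (simp add: degree_pCons_eq_if)
  then have "degree r' \<le> n" unfolding r'_def
    using f by (intro degree_diff_le) (auto intro: order_trans[OF degree_smult_le])
  moreover have "coeff r' n = 0" using f by (simp add: r'_def l_def mult.commute del: smult_pCons)
  ultimately have 2: "degree r' < n"
    using f(3) by (metis degree_0 leading_coeff_0_iff nat_less_le)
  have "smult (l ^ Suc m) (monom 1 (Suc m)) - r'
     = [:0, l:] * (smult (l ^ m) (monom 1 m) - r) + smult (coeff (pCons 0 r) n) f"
    by (simp add: r'_def algebra_simps monom_Suc smult_diff_right)
  moreover have "f dvd \<dots>"
    using r(3) by (intro dvd_add dvd_mult dvd_smult) (auto simp: l_def)
  ultimately show ?case using 1 2 unfolding l_def by metis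
qed

lemma smult_sum_poly:
  fixes g :: "'b \<Rightarrow> complex poly"
  shows "smult c (\<Sum>i\<in>S. g i) = (\<Sum>i\<in>S. smult c (g i))"
  by (induction S rule: infinite_finite_induct) (auto simp: smult_add_right)

text \<open>The factor depends only on \<open>f\<close> and the degree bound \<open>N\<close>, not
  on \<open>p\<close>. It is thus one denominator common to all elements treated in
  \<open>finite_bounded_int_values\<close>.\<close>

lemma pseudo_reduce:
  assumes f: "int_poly f" "degree f = n" "n > 0" and p: "int_poly p" "degree p \<le> N"
  shows "\<exists>r. int_poly r \<and> degree r < n \<and> f dvd (smult (lead_coeff f ^ N) p - r)"
proof -
  define l where "l = lead_coeff f"
  have l: "l \<in> \<int>" using f by (auto simp: l_def int_poly_def)
  obtain r where r: "\<And>m. int_poly (r m)" "\<And>m. degree (r m) < n"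
      "\<And>m. f dvd (smult (l ^ m) (monom 1 m) - r m)"
    using pseudo_reduce_monom[OF f] unfolding l_def by metis
  \<comment> \<open>The factor \<open>l ^ (N - i)\<close> raises the denominator
    \<open>l ^ i\<close> of the \<open>i\<close>-th monomial to the common
    \<open>l ^ N\<close>.\<close>
  define R where "R = (\<Sum>i\<le>N. smult (coeff p i * l ^ (N - i)) (r i))"
  have "int_poly R" unfolding R_def using p l r
    by (intro int_poly_sum int_poly_smult Ints_mult Ints_power) (auto simp: int_poly_def)
  moreover have "degree R \<le> n - 1" unfolding R_def
  proof (intro degree_sum_le)
    fix i show "degree (smult (coeff p i * l ^ (N - i)) (r i)) \<le> n - 1"
      using r(2)[of i] degree_smult_le[of "coeff p i * l ^ (N - i)" "r i"] by linarith
  qed auto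
  moreover have "smult (l ^ N) p - R
     = (\<Sum>i\<le>N. smult (coeff p i * l ^ (N - i)) (smult (l ^ i) (monom 1 i) - r i))"
  proof -
    have "smult (l ^ N) p = (\<Sum>i\<le>N. smult (l ^ N) (monom (coeff p i) i))"
      by (simp only: poly_as_sum_of_monoms'[OF p(2)] flip: smult_sum_poly)
    also have "\<dots> = (\<Sum>i\<le>N. smult (coeff p i * l ^ (N - i)) (smult (l ^ i) (monom 1 i)))"
    proof (intro sum.cong refl)
      fix i assume "i \<in> {..N}"
      then have "l ^ N = l ^ (N - i) * l ^ i" by (simp flip: power_add)
      then show "smult (l ^ N) (monom (coeff p i) i)
          = smult (coeff p i * l ^ (N - i)) (smult (l ^ i) (monom 1 i))"
        by (simp add: smult_monom)
    qed
    finally show ?thesis by (simp add: R_def sum_subtractf smult_diff_right)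
  qed
  moreover have "f dvd \<dots>" using r(3) by (intro dvd_sum dvd_smult) auto
  ultimately have "int_poly R" "degree R < n" "f dvd (smult (l ^ N) p - R)"
    using f(3) by simp_all
  then show ?thesis unfolding l_def by blast
qed

text \<open>An integer polynomial \<open>f\<close> of least degree with root \<open>z\<close> is separable
  because it divides \<open>X\<^sup>N - 1\<close>, and its roots are conjugates of \<open>z\<close>.\<close>

lemma minimal_int_poly:
  assumes z: "z ^ N = 1" "N > 0"
  obtains f where "int_poly f" "f \<noteq> 0" "degree f > 0"
    "finite (conjugates z)" "card (conjugates z) = degree f"
    "\<And>w. w \<in> conjugates z \<longleftrightarrow> poly f w = 0"
proof -
  define A where "A = {p. int_poly p \<and> p \<noteq> 0 \<and> poly p z = 0}"
  define g :: "complex poly" where "g = monom 1 N - 1"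
  have cg: "coeff g N = 1" using z by (simp add: g_def)
  have "g \<noteq> 0" using cg z by auto
  moreover have "int_poly g" "poly g z = 0"
    using z by (auto simp: g_def poly_monom intro!: int_poly_diff int_poly_monom)
  ultimately have g: "g \<in> A" by (simp add: A_def)
  have "degree g \<le> N" unfolding g_def by (intro degree_diff_le) (auto simp: degree_monom_le)
  define f where "f = arg_min degree (\<lambda>p. p \<in> A)"
  have fA: "f \<in> A" unfolding f_def using g by (rule arg_min_natI)
  have fmin: "degree f \<le> degree p" if "p \<in> A" for p
    unfolding f_def using that by (rule arg_min_nat_le)
  have f: "int_poly f" "f \<noteq> 0" "poly f z = 0" using fA by (auto simp: A_def)
  have df: "degree f > 0"
    using f(2,3) by (auto elim!: degree_eq_zeroE intro!: gr0I)
  have dvd: "f dvd p" if p: "int_poly p" "poly p z = 0" for p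
  proof -
    obtain r where r: "int_poly r" "degree r < degree f"
        "f dvd (smult (lead_coeff f ^ degree p) p - r)"
      using pseudo_reduce[OF f(1) refl df p(1) order_refl] by blast
    then have "poly (smult (lead_coeff f ^ degree p) p - r) z = 0"
      using root_of_dvd f(3) by blast
    then have "poly r z = 0" using p by simp
    then have "r = 0" using fmin[of r] r by (auto simp: A_def)
    then show ?thesis using r f(2) by (auto simp: dvd_smult_iff)
  qed
  have roots: "w \<in> conjugates z \<longleftrightarrow> poly f w = 0" for w
    using dvd f root_of_dvd by (auto simp: conjugates_def)
  then have eq: "conjugates z = {w. poly f w = 0}" by blast
  have fin: "finite (conjugates z)" unfolding eq using f(2) by (rule poly_roots_finite)
  obtain q where q: "g = f * q" using dvd[of g] g by (auto simp: A_def elim: dvdE)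
  have "q \<noteq> 0" using q g by (auto simp: A_def)
  have "{w. poly g w = 0} = {w. w ^ N = 1}" by (auto simp: g_def poly_monom)
  \<comment> \<open>The \<open>N\<close> distinct roots of \<open>g\<close> are shared between
    \<open>f\<close> and \<open>q\<close>, whose degrees add up to at most \<open>N\<close>, so
    \<open>f\<close> cannot have fewer roots than its degree.\<close>
  then have "N = card {w. poly g w = 0}" using card_roots_unity_eq[of N] z by simp
  also have "{w. poly g w = 0} = {w. poly f w = 0} \<union> {w. poly q w = 0}" by (auto simp: q)
  also have "card \<dots> \<le> card {w. poly f w = 0} + card {w. poly q w = 0}" by (rule card_Un_le)
  also have "\<dots> \<le> card {w. poly f w = 0} + degree q"
    using card_poly_roots_bound[OF \<open>q \<noteq> 0\<close>] by simp
  finally have "degree f + degree q \<le> card {w. poly f w = 0} + degree q"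
    using \<open>degree g \<le> N\<close> degree_mult_eq[OF f(2) \<open>q \<noteq> 0\<close>] q by simp
  then have "card (conjugates z) = degree f"
    using card_poly_roots_bound[OF f(2)] unfolding eq by simp
  then show ?thesis using that f df fin roots by blast
qed

section \<open>Real values at the conjugates, and their discreteness\<close>

text \<open>An element of the real subring of \<open>\<int>[z]\<close> is represented together with its images under
  the conjugations \<open>z \<mapsto> w\<close>, as a function of \<open>w\<close>; values off \<open>conjugates z\<close> are junk.\<close>

definition int_values :: "complex \<Rightarrow> (complex \<Rightarrow> real) set" where
  "int_values z = {u. \<exists>p. int_poly p \<and> (\<forall>w\<in>conjugates z. complex_of_real (u w) = poly p w)}"

lemma int_values_const: "c \<in> \<int> \<Longrightarrow> (\<lambda>w. c) \<in> int_values z"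
  unfolding int_values_def
  by (rule CollectI, rule exI[of _ "[:complex_of_real c:]"]) (auto intro!: int_poly_const elim: Ints_cases)

lemma int_values_add:
  "u \<in> int_values z \<Longrightarrow> v \<in> int_values z \<Longrightarrow> (\<lambda>w. u w + v w) \<in> int_values z"
  unfolding int_values_def
  by (smt (verit) int_poly_add mem_Collect_eq of_real_add poly_add)

lemma int_values_diff:
  "u \<in> int_values z \<Longrightarrow> v \<in> int_values z \<Longrightarrow> (\<lambda>w. u w - v w) \<in> int_values z"
  unfolding int_values_def
  by (smt (verit) int_poly_diff mem_Collect_eq of_real_diff poly_diff)

lemma int_values_mult:
  "u \<in> int_values z \<Longrightarrow> v \<in> int_values z \<Longrightarrow> (\<lambda>w. u w * v w) \<in> int_values z"
  unfolding int_values_def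
  by (smt (verit) int_poly_mult mem_Collect_eq of_real_mult poly_mult)

text \<open>Integer polynomials that agree at \<open>z\<close> agree at every conjugate. This
  carries equations known only at \<open>z\<close>, such as that of a rational angle, to the other
  conjugates.\<close>

lemma int_values_eqI:
  assumes "u \<in> int_values z" "v \<in> int_values z" "u z = v z" "w \<in> conjugates z"
  shows "u w = v w"
proof -
  obtain p q where "int_poly p" "\<forall>w\<in>conjugates z. complex_of_real (u w) = poly p w"
    "int_poly q" "\<forall>w\<in>conjugates z. complex_of_real (v w) = poly q w"
    using assms by (auto simp: int_values_def)
  then show ?thesis
    using conjugates_eqI[of w z p q] assms self_conjugate[of z] by (metis of_real_eq_iff)
qed

text \<open>On the unit circle conjugation is inversion, and inversion is the power
  \<open>N - 1\<close>; so twice the real part is given by one integer polynomial for all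
  conjugates.\<close>

lemma int_values_unity:
  assumes "z ^ N = 1" "N > 0"
  shows "(\<lambda>w. 2 * Re (w ^ a)) \<in> int_values z"
proof -
  have "complex_of_real (2 * Re (w ^ a)) = poly (monom 1 a + monom 1 ((N - 1) * a)) w"
    if "w \<in> conjugates z" for w
  proof -
    have w: "w ^ N = 1" using conjugates_unity that assms by blast
    then have "norm w ^ N = 1" by (metis norm_power norm_one)
    then have "norm w = 1"
      using assms(2) power_eq_imp_eq_base[of "norm w" N 1] by simp
    then have "w * cnj w = 1" by (simp add: complex_norm_square[symmetric])
    moreover have "w * w ^ (N - 1) = 1" using w assms(2) by (metis power_minus_mult mult.commute)
    ultimately have "w ^ (N - 1) = cnj w"
      by (metis mult.assoc mult.commute mult.left_neutral)
    then have "w ^ ((N - 1) * a) = cnj (w ^ a)" by (simp add: power_mult)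
    then show ?thesis by (simp add: poly_monom complex_add_cnj flip: complex_cnj_power)
  qed
  then show ?thesis unfolding int_values_def
    by (auto intro!: exI[of _ "monom 1 a + monom 1 ((N - 1) * a)"] int_poly_add int_poly_monom)
qed

lemma finite_bounded_int_polys: "finite {r. int_poly r \<and> degree r < n \<and> (\<forall>i. norm (coeff r i) \<le> K)}"
proof -
  define F where "F = (\<lambda>g. \<Sum>i<n. monom (complex_of_int (g i)) i)"
  have "r \<in> F ` (PiE {..<n} (\<lambda>_. {-\<lceil>K\<rceil>..\<lceil>K\<rceil>}))"
    if r: "int_poly r" "degree r < n" "\<forall>i. norm (coeff r i) \<le> K" for r
  proof -
    have "\<forall>i. \<exists>k. coeff r i = of_int k"
      using r(1) unfolding int_poly_def by (blast elim: Ints_cases)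
    then obtain h where h: "\<And>i. coeff r i = of_int (h i)" by (auto simp: choice_iff)
    have "\<bar>real_of_int (h i)\<bar> \<le> K" for i using r(3) h[of i] by (metis norm_of_int)
    then have "\<bar>h i\<bar> \<le> \<lceil>K\<rceil>" for i
      using ceiling_mono[of "\<bar>real_of_int (h i)\<bar>" K] by (simp flip: of_int_abs)
    then have "h i \<in> {-\<lceil>K\<rceil>..\<lceil>K\<rceil>}" for i by (simp add: abs_le_iff minus_le_iff)
    then have "restrict h {..<n} \<in> PiE {..<n} (\<lambda>_. {-\<lceil>K\<rceil>..\<lceil>K\<rceil>})" by auto
    moreover have "r = F (restrict h {..<n})"
    proof -
      have "r = (\<Sum>i\<le>n-1. monom (coeff r i) i)" using r(2) by (subst poly_as_sum_of_monoms') auto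
      also have "{..n-1} = {..<n}" using r(2) by auto
      finally show ?thesis unfolding F_def by (simp add: h)
    qed
    ultimately show ?thesis by blast
  qed
  then have "{r. int_poly r \<and> degree r < n \<and> (\<forall>i. norm (coeff r i) \<le> K)}
      \<subseteq> F ` (PiE {..<n} (\<lambda>_. {-\<lceil>K\<rceil>..\<lceil>K\<rceil>}))" by blast
  then show ?thesis by (rule finite_subset) (intro finite_imageI finite_PiE; simp)
qed

text \<open>Lagrange interpolation on the conjugates bounds the coefficients.\<close>

lemma finite_bounded_on_set:
  assumes G: "finite G" "card G = n"
  shows "finite {r. int_poly r \<and> degree r < n \<and> (\<forall>v\<in>G. norm (poly r v) \<le> M)}"
proof -
  define L where "L v = (\<Prod>x\<in>G - {v}. smult (inverse (v - x)) [:-x, 1:])" for v :: complex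
  have Lval: "poly (L v) w = (if w = v then 1 else 0)" if "v \<in> G" "w \<in> G" for v w
  proof -
    have "poly (L v) w = (\<Prod>x\<in>G - {v}. inverse (v - x) * (w - x))"
      by (simp add: L_def poly_prod algebra_simps)
    also have "\<dots> = (if w = v then 1 else 0)"
    proof (cases "w = v")
      case True
      then show ?thesis by (auto intro!: prod.neutral left_inverse)
    next
      case False
      then have "w \<in> G - {v}" "inverse (v - w) * (w - w) = 0" using that by auto
      then have "(\<Prod>x\<in>G - {v}. inverse (v - x) * (w - x)) = 0"
        using G by (intro prod_zero) (auto intro!: bexI[of _ w])
      then show ?thesis using False by simp
    qed
    finally show ?thesis .
  qed
  have Ldeg: "degree (L v) < n" if "v \<in> G" for v
  proof -
    have "degree (L v) \<le> (\<Sum>x\<in>G - {v}. degree (smult (inverse (v - x)) [:-x, 1:]))"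
      unfolding L_def using degree_prod_sum_le[of "G - {v}" "\<lambda>x. smult (inverse (v - x)) [:-x, 1:]"] G
      by (simp add: comp_def)
    also have "\<dots> \<le> (\<Sum>x\<in>G - {v}. 1)" by (intro sum_mono) (auto simp: degree_smult_eq)
    also have "\<dots> < n" using that G card_Diff1_less[of G v] by simp
    finally show ?thesis .
  qed
  have interp: "r = (\<Sum>v\<in>G. smult (poly r v) (L v))" if r: "degree r < n" for r
  proof (rule poly_eqI_degree[of G])
    fix w assume "w \<in> G"
    then have "(\<Sum>v\<in>G. poly r v * poly (L v) w) = (\<Sum>v\<in>G. if v = w then poly r v else 0)"
      using Lval by (intro sum.cong) auto
    then show "poly r w = poly (\<Sum>v\<in>G. smult (poly r v) (L v)) w"
      using G \<open>w \<in> G\<close> by (simp add: poly_sum)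
  next
    show "degree r < card G" using r G by simp
    have "degree (\<Sum>v\<in>G. smult (poly r v) (L v)) \<le> n - 1"
      using G
    proof (intro degree_sum_le)
      fix v assume "v \<in> G"
      then show "degree (smult (poly r v) (L v)) \<le> n - 1"
        using Ldeg[of v] degree_smult_le[of "poly r v" "L v"] by linarith
    qed
    then show "degree (\<Sum>v\<in>G. smult (poly r v) (L v)) < card G" using r G by linarith
  qed
  define K where "K = (\<Sum>i<n. \<Sum>v\<in>G. M * norm (coeff (L v) i))"
  have "norm (coeff r i) \<le> K" if r: "degree r < n" "\<forall>v\<in>G. norm (poly r v) \<le> M" for r i
  proof -
    \<comment> \<open>Nonnegativity of \<open>M\<close> is not assumed; any point of
      \<open>G\<close> provides it, and for empty \<open>G\<close> the sums vanish.\<close>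
    have M: "0 \<le> M" if "v \<in> G" for v using r(2) that by (meson norm_ge_zero order_trans)
    then have nn: "0 \<le> (\<Sum>v\<in>G. M * norm (coeff (L v) j))" for j by (intro sum_nonneg) auto
    show ?thesis
    proof (cases "i < n")
      case True
      have "norm (coeff r i) = norm (\<Sum>v\<in>G. poly r v * coeff (L v) i)"
        using arg_cong[OF interp[OF r(1)], of "\<lambda>p. coeff p i"] by (simp add: coeff_sum)
      also have "\<dots> \<le> (\<Sum>v\<in>G. M * norm (coeff (L v) i))"
        using r(2) by (intro sum_norm_le) (auto simp: norm_mult intro!: mult_right_mono)
      also have "\<dots> \<le> K" unfolding K_def using True nn
        by (intro member_le_sum[of i "{..<n}" "\<lambda>i. \<Sum>v\<in>G. M * norm (coeff (L v) i)"]) auto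
      finally show ?thesis .
    next
      case False
      then have "coeff r i = 0" using r(1) by (simp add: coeff_eq_0)
      moreover have "0 \<le> K" unfolding K_def by (rule sum_nonneg) (rule nn)
      ultimately show ?thesis by simp
    qed
  qed
  then have "{r. int_poly r \<and> degree r < n \<and> (\<forall>v\<in>G. norm (poly r v) \<le> M)}
      \<subseteq> {r. int_poly r \<and> degree r < n \<and> (\<forall>i. norm (coeff r i) \<le> K)}" by blast
  then show ?thesis by (rule finite_subset) (rule finite_bounded_int_polys)
qed

text \<open>This is the discreteness of algebraic integers under all their embeddings at once. Up to
  the fixed factor \<open>c\<close>, every \<open>u\<close> is represented by an integer polynomial
  of degree below the number of conjugates, and \<open>finite_bounded_on_set\<close> leaves finitely
  many of these.\<close>

lemma finite_bounded_int_values: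
  assumes z: "z ^ N = 1" "N > 0" and w: "w \<in> conjugates z"
  shows "finite ((\<lambda>u. u w) ` {u \<in> int_values z. \<forall>v\<in>conjugates z. \<bar>u v\<bar> \<le> M})"
proof -
  obtain f where f: "int_poly f" "f \<noteq> 0" "degree f > 0"
    and G: "finite (conjugates z)" "card (conjugates z) = degree f"
    and roots: "\<And>w. w \<in> conjugates z \<longleftrightarrow> poly f w = 0"
    using minimal_int_poly[OF z] by metis
  define c where "c = lead_coeff f ^ N"
  have c: "c \<noteq> 0" using f by (simp add: c_def)
  define S where "S = {r. int_poly r \<and> degree r < degree f \<and> (\<forall>v\<in>conjugates z. norm (poly r v) \<le> norm c * M)}"
  have "u w \<in> (\<lambda>r. Re (poly r w / c)) ` S"
    if u: "u \<in> int_values z" "\<forall>v\<in>conjugates z. \<bar>u v\<bar> \<le> M" for u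
  proof -
    obtain p where p: "int_poly p" "\<And>w. w \<in> conjugates z \<Longrightarrow> complex_of_real (u w) = poly p w"
      using u by (auto simp: int_values_def)
    \<comment> \<open>All conjugates are \<open>N\<close>-th roots of unity, so reducing exponents
      modulo \<open>N\<close> changes no value there and bounds the degree before the
      pseudo-division.\<close>
    define q where "q = (\<Sum>i\<le>degree p. monom (coeff p i) (i mod N))"
    have q: "int_poly q" unfolding q_def using p(1)
      by (intro int_poly_sum int_poly_monom) (auto simp: int_poly_def)
    have dq: "degree q \<le> N" unfolding q_def
    proof (intro degree_sum_le)
      fix i show "degree (monom (coeff p i) (i mod N)) \<le> N"
        using degree_monom_le[of "coeff p i" "i mod N"] mod_less_divisor[of N i] z by linarith
    qed simp
    have pq: "poly q v = poly p v" if "v \<in> conjugates z" for v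
    proof -
      have v: "v ^ N = 1" using conjugates_unity z that by blast
      have "v ^ i = (v ^ N) ^ (i div N) * v ^ (i mod N)" for i
        by (simp flip: power_mult power_add)
      then have "v ^ (i mod N) = v ^ i" for i by (simp add: v)
      then show ?thesis by (simp add: q_def poly_sum poly_monom poly_altdef[of p])
    qed
    obtain r where r: "int_poly r" "degree r < degree f" "f dvd (smult c q - r)"
      using pseudo_reduce[OF f(1) refl f(3) q dq] unfolding c_def by blast
    have rv: "poly r v = c * complex_of_real (u v)" if "v \<in> conjugates z" for v
    proof -
      have "poly (smult c q - r) v = 0" using r(3) roots that root_of_dvd by blast
      then show ?thesis using pq p(2) that by simp
    qed
    have "r \<in> S" using r u(2) by (auto simp: S_def rv norm_mult intro!: mult_left_mono)
    moreover have "u w = Re (poly r w / c)" using rv[OF w] c by simp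
    ultimately show ?thesis by blast
  qed
  then have "(\<lambda>u. u w) ` {u \<in> int_values z. \<forall>v\<in>conjugates z. \<bar>u v\<bar> \<le> M}
      \<subseteq> (\<lambda>r. Re (poly r w / c)) ` S" by blast
  moreover have "finite S" unfolding S_def by (rule finite_bounded_on_set[OF G])
  ultimately show ?thesis using finite_subset[OF _ finite_imageI] by blast
qed

section \<open>Chebyshev polynomials and rational angles\<close>

text \<open>This is \<open>2 * T n (x / 2)\<close> for the Chebyshev polynomial \<open>T n\<close>
  of the first kind. In this scaling the coefficients are integers, so \<open>int_values z\<close>
  is preserved.\<close>

fun chebyshev :: "nat \<Rightarrow> real \<Rightarrow> real" where
  "chebyshev 0 x = 2"
| "chebyshev (Suc 0) x = x"
| "chebyshev (Suc (Suc n)) x = x * chebyshev (Suc n) x - chebyshev n x"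

lemma chebyshev_cos: "chebyshev n (2 * cos t) = 2 * cos (real n * t)"
proof (induction n "2 * cos t" rule: chebyshev.induct)
  case (3 n)
  have "cos (real (Suc (Suc n)) * t) = cos (real (Suc n) * t + t)"
    "cos (real n * t) = cos (real (Suc n) * t - t)" by (simp_all add: algebra_simps)
  then have "2 * cos (real (Suc (Suc n)) * t) = 4 * cos (real (Suc n) * t) * cos t - 2 * cos (real n * t)"
    unfolding cos_add cos_diff by simp
  then show ?case using 3 by simp
qed auto

text \<open>The recursion makes the next absolute value at least twice the current one minus the
  previous one, and the previous one is smaller by induction.\<close>

lemma chebyshev_growth:
  assumes "\<bar>x\<bar> > 2"
  shows "\<bar>chebyshev (Suc n) x\<bar> > \<bar>chebyshev n x\<bar>"
proof (induction n)
  case (Suc n)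
  have "\<bar>x\<bar> * \<bar>chebyshev (Suc n) x\<bar> \<ge> 2 * \<bar>chebyshev (Suc n) x\<bar>"
    using assms by (intro mult_right_mono) auto
  then show ?case using Suc by (simp add: abs_mult[symmetric])
qed (use assms in auto)

text \<open>Outside the interval the absolute values increase strictly from the initial value 2, so
  the value 2 cannot recur.\<close>

lemma chebyshev_eq_2:
  assumes "chebyshev n x = 2" "n > 0"
  shows "\<bar>x\<bar> \<le> 2"
proof (rule ccontr)
  assume "\<not> \<bar>x\<bar> \<le> 2"
  then have "strict_mono (\<lambda>n. \<bar>chebyshev n x\<bar>)"
    by (intro strict_monoI_Suc chebyshev_growth) auto
  then have "\<bar>chebyshev 0 x\<bar> < \<bar>chebyshev n x\<bar>" using assms(2) by (rule strict_monoD)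
  then show False using assms(1) by simp
qed

lemma int_values_chebyshev:
  "u \<in> int_values z \<Longrightarrow> (\<lambda>w. chebyshev n (u w)) \<in> int_values z"
  by (induction n x\<equiv>"0::real" rule: chebyshev.induct)
     (auto intro!: int_values_const int_values_diff int_values_mult)

text \<open>These numbers are the traces of the elements of finite order in SU(2).\<close>

definition rational_angle :: "real \<Rightarrow> bool" where
  "rational_angle x \<longleftrightarrow> (\<exists>r\<in>\<rat>. x = 2 * cos (2 * pi * r))"

text \<open>A rational angle satisfies an equation \<open>chebyshev n x = 2\<close> with
  \<open>n > 0\<close>. The equation transfers to the conjugates, and \<open>chebyshev_eq_2\<close>
  locates its real solutions.\<close>

lemma rational_angle_conjugates:
  assumes u: "u \<in> int_values z" and r: "rational_angle (u z)" and w: "w \<in> conjugates z"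
  shows "\<bar>u w\<bar> \<le> 2"
proof -
  obtain r where "r \<in> \<rat>" and uz: "u z = 2 * cos (2 * pi * r)"
    using r by (auto simp: rational_angle_def)
  then obtain m n where n: "n > 0" and rmn: "r = real_of_int m / real_of_int n"
    by (metis Rats_cases' )
  have "chebyshev (nat n) (u z) = 2 * cos (2 * pi * of_int m)"
    unfolding uz chebyshev_cos rmn using n by simp
  also have "\<dots> = 2" using cos_int_2pin[of m] by simp
  finally have "chebyshev (nat n) (u w) = 2"
    using int_values_eqI[OF int_values_chebyshev[OF u] int_values_const[of 2], of "nat n" w] w by simp
  then show ?thesis using n chebyshev_eq_2 by auto
qed

text \<open>All multiples \<open>N\<close> of \<open>n\<close> are allowed so that several numbers
  can be expressed by one common root of unity.\<close>

lemma rational_angle_unity: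
  assumes "rational_angle x"
  shows "\<exists>n>0. \<forall>N>0. n dvd N \<longrightarrow> (\<exists>a. x = 2 * Re (cis (2 * pi / real N) ^ a))"
proof -
  obtain r where r: "r \<in> \<rat>" "x = 2 * cos (2 * pi * r)" using assms by (auto simp: rational_angle_def)
  \<comment> \<open>The cosine is even; a nonnegative angle permits a natural number as
    exponent.\<close>
  then have x: "x = 2 * cos (2 * pi * \<bar>r\<bar>)"
    by (metis abs_if cos_minus mult_minus_right)
  obtain m n where n: "n \<noteq> 0" and rmn: "\<bar>r\<bar> = real m / real n"
    using Rats_abs_nat_div_natE[OF r(1)] by metis
  have "\<exists>a. x = 2 * Re (cis (2 * pi / real N) ^ a)" if N: "N > 0" "n dvd N" for N
  proof -
    obtain d where d: "N = n * d" using N by (elim dvdE)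
    have "real (m * d) * (2 * pi / real N) = 2 * pi * \<bar>r\<bar>"
      using n N by (simp add: rmn d field_simps)
    then have "cis (2 * pi / real N) ^ (m * d) = cis (2 * pi * \<bar>r\<bar>)"
      unfolding Complex.DeMoivre by (rule arg_cong)
    then have "x = 2 * Re (cis (2 * pi / real N) ^ (m * d))" using x by simp
    then show ?thesis by blast
  qed
  then show ?thesis using n by blast
qed

section \<open>Finite orbits have \<open>kappa\<close> at most 2\<close>

text \<open>As a quadratic in \<open>x\<close>, the excess over 4 has discriminant
  \<open>(4 - y\<^sup>2) * (4 - z\<^sup>2)\<close>, and \<open>vieta\<close> puts \<open>x\<close>
  at or beyond the vertex \<open>y * z / 2\<close>. Raising \<open>x\<close> to \<open>y\<close>
  therefore keeps a positive excess, which then amounts to \<open>2 + z < y\<^sup>2\<close>,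
  impossible for \<open>y\<close> at most \<open>z\<close> and 2.\<close>

lemma kappa_le_2_sorted:
  fixes x y z :: real
  assumes bnd: "\<bar>x\<bar> \<le> 2" "\<bar>y\<bar> \<le> 2" "\<bar>z\<bar> \<le> 2" and ord: "x \<le> y" "y \<le> z" "0 \<le> x + y"
    and vieta: "y * z \<le> 2 * x"
  shows "x\<^sup>2 + y\<^sup>2 + z\<^sup>2 - x*y*z \<le> 4"
proof (rule ccontr)
  assume "\<not> ?thesis"
  then have gt: "x\<^sup>2 + y\<^sup>2 + z\<^sup>2 - x*y*z > 4" by simp
  have y: "0 \<le> y" using ord by linarith
  have eq: "(2*x - y*z)\<^sup>2 - (4 - y\<^sup>2) * (4 - z\<^sup>2) = 4 * (x\<^sup>2 + y\<^sup>2 + z\<^sup>2 - x*y*z - 4)"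
    by (simp add: power2_eq_square algebra_simps)
  have "0 < (2*x - y*z)\<^sup>2 - (4 - y\<^sup>2) * (4 - z\<^sup>2)" unfolding eq using gt by simp
  then have 1: "(4 - y\<^sup>2) * (4 - z\<^sup>2) < (2*x - y*z)\<^sup>2" by simp
  have "(2*x - y*z)\<^sup>2 \<le> (2*y - y*z)\<^sup>2"
    using vieta ord(1) by (intro power_mono) auto
  with 1 have 2: "(4 - y\<^sup>2) * (4 - z\<^sup>2) < y\<^sup>2 * (2 - z)\<^sup>2"
    by (simp add: power2_eq_square algebra_simps)
  have z2: "z \<noteq> 2"
  proof
    assume "z = 2"
    then show False using 2 by simp
  qed
  have "(2 - z) * ((4 - y\<^sup>2) * (2 + z)) < (2 - z) * (y\<^sup>2 * (2 - z))"
    using 2 by (simp add: power2_eq_square algebra_simps)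
  then have "(4 - y\<^sup>2) * (2 + z) < y\<^sup>2 * (2 - z)"
    using z2 bnd(3) by (simp add: mult_less_cancel_left)
  then have "2 + z < y\<^sup>2" by (simp add: algebra_simps)
  moreover have "y\<^sup>2 \<le> 2 * y" using y bnd(2) by (simp add: power2_eq_square mult_right_mono)
  moreover have "y \<le> 2" using bnd by linarith
  ultimately show False using ord by linarith
qed

text \<open>The hypotheses say that \<open>x + y + z\<close> does not grow under a sign change of
  two coordinates or under a Vieta move such as \<open>x\<close> to \<open>y * z - x\<close>. They
  are symmetric, so the coordinates can be sorted.\<close>

lemma kappa_le_2_locally_maximal:
  fixes x y z :: real
  assumes bnd: "\<bar>x\<bar> \<le> 2" "\<bar>y\<bar> \<le> 2" "\<bar>z\<bar> \<le> 2"
    and pos: "0 \<le> x + y" "0 \<le> y + z" "0 \<le> x + z"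
    and vieta: "y * z \<le> 2 * x" "x * z \<le> 2 * y" "x * y \<le> 2 * z"
  shows "x\<^sup>2 + y\<^sup>2 + z\<^sup>2 - x*y*z \<le> 4"
proof -
  note s = kappa_le_2_sorted
  consider "x \<le> y" "y \<le> z" | "x \<le> z" "z \<le> y" | "y \<le> x" "x \<le> z" | "y \<le> z" "z \<le> x"
    | "z \<le> x" "x \<le> y" | "z \<le> y" "y \<le> x" by linarith
  then show ?thesis
  proof cases
    case 1 then show ?thesis using s[of x y z] assms by (simp add: ac_simps)
  next
    case 2 then show ?thesis using s[of x z y] assms by (simp add: ac_simps)
  next
    case 3 then show ?thesis using s[of y x z] assms by (simp add: ac_simps)
  next
    case 4 then show ?thesis using s[of y z x] assms by (simp add: ac_simps)
  next
    case 5 then show ?thesis using s[of z x y] assms by (simp add: ac_simps)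
  next
    case 6 then show ?thesis using s[of z y x] assms by (simp add: ac_simps)
  qed
qed

lemma kappa_tau [simp]:
  "kappa (tauX p) = kappa p" "kappa (tauY p) = kappa p"
  "kappa (tauX_inv p) = kappa p" "kappa (tauY_inv p) = kappa p"
  by (auto simp: kappa_def tauX_def tauY_def tauX_inv_def tauY_inv_def power2_eq_square
      algebra_simps split: prod.splits)

lemma kappa_Gamma_orbit: "q \<in> Gamma_orbit p \<Longrightarrow> kappa q = kappa p"
  by (induction rule: Gamma_orbit.induct) auto

text \<open>The invariant function \<open>h\<close> is the maximum of \<open>x + y + z\<close> over the sign changes of
  pairs of coordinates, which commute with the twists.\<close>

lemma finite_orbit_kappa_le_2:
  assumes fin: "finite (Gamma_orbit p)"
    and bnd: "\<And>x y z. (x, y, z) \<in> Gamma_orbit p \<Longrightarrow> \<bar>x\<bar> \<le> 2 \<and> \<bar>y\<bar> \<le> 2 \<and> \<bar>z\<bar> \<le> 2"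
  shows "kappa p \<le> 2"
proof -
  define T where "T = Gamma_orbit p \<times> {-1, 1::real} \<times> {-1, 1::real}"
  define h where "h = (\<lambda>((x, y, z), e, d). e * x + d * y + e * d * z :: real)"
  have T: "finite T" "T \<noteq> {}" using fin Gamma_orbit.base[of p] by (auto simp: T_def)
  have "Max (h ` T) \<in> h ` T" using T by (intro Max_in) auto
  then obtain t where "t \<in> T" "Max (h ` T) = h t" by blast
  then have t: "t \<in> T" "\<And>t'. t' \<in> T \<Longrightarrow> h t' \<le> h t"
    using Max_ge[of "h ` T"] T(1) by auto
  obtain x y z e d where tt: "t = ((x, y, z), e, d)" by (cases t) auto
  have orb: "(x, y, z) \<in> Gamma_orbit p" and ed: "e = -1 \<or> e = 1" "d = -1 \<or> d = 1"
    using t(1) by (auto simp: T_def tt)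
  define X Y Z where "X = e * x" and "Y = d * y" and "Z = e * d * z"
  have 1: "e' * x + d' * y + e' * d' * z \<le> X + Y + Z"
    if "e' = -1 \<or> e' = 1" "d' = -1 \<or> d' = 1" for e' d'
    using t(2)[of "((x, y, z), e', d')"] orb that by (auto simp: T_def tt h_def X_def Y_def Z_def)
  have pos: "0 \<le> X + Y" "0 \<le> Y + Z" "0 \<le> X + Z"
    using 1[of "-e" "-d"] 1[of "-e" d] 1[of e "-d"] ed by (auto simp: X_def Y_def Z_def)
  have 2: "e' * a + d' * b + e' * d' * c \<le> X + Y + Z"
    if "(a, b, c) \<in> Gamma_orbit p" "e' = -1 \<or> e' = 1" "d' = -1 \<or> d' = 1" for a b c e' d'
    using t(2)[of "((a, b, c), e', d')"] that by (auto simp: T_def tt h_def X_def Y_def Z_def)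
  \<comment> \<open>Up to the order of the coordinates these are the three Vieta moves. The signs
    chosen below follow the permutation of the coordinates.\<close>
  have "(x, z, x*z - y) \<in> Gamma_orbit p" "(x, x*y - z, y) \<in> Gamma_orbit p" "(z, y, y*z - x) \<in> Gamma_orbit p"
    using Gamma_orbit.tX[OF orb] Gamma_orbit.tXi[OF orb] Gamma_orbit.tY[OF orb]
    by (simp_all add: tauX_def tauX_inv_def tauY_def)
  from 2[OF this(1), of e "e * d"] 2[OF this(2), of e "e * d"] 2[OF this(3), of "e * d" d]
  have vieta: "Y * Z \<le> 2 * X" "X * Z \<le> 2 * Y" "X * Y \<le> 2 * Z"
    using ed by (auto simp: X_def Y_def Z_def algebra_simps)
  have "X\<^sup>2 + Y\<^sup>2 + Z\<^sup>2 - X*Y*Z \<le> 4"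
    using bnd[OF orb] ed pos vieta
    by (intro kappa_le_2_locally_maximal) (auto simp: X_def Y_def Z_def)
  moreover have "X\<^sup>2 + Y\<^sup>2 + Z\<^sup>2 - X*Y*Z = kappa (x, y, z) + 2"
    using ed by (auto simp: X_def Y_def Z_def kappa_def)
  ultimately show ?thesis using kappa_Gamma_orbit[OF orb] by simp
qed

section \<open>Matrices in SU(2) and trace identities\<close>

text \<open>Without a norm condition these matrices are the real quaternions. They are closed under
  sums and real multiples, so matrix identities in SU(2) reduce to identities between two complex
  entries.\<close>

definition su2 :: "complex \<Rightarrow> complex \<Rightarrow> cmat2" where
  "su2 a b = vector [vector [a, b], vector [- cnj b, cnj a]]"

lemma su2_nth [simp]:
  "su2 a b $ 1 $ 1 = a" "su2 a b $ 1 $ 2 = b" "su2 a b $ 2 $ 1 = - cnj b" "su2 a b $ 2 $ 2 = cnj a"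
  by (simp_all add: su2_def)

lemma mat2_eq_iff:
  fixes A B :: cmat2
  shows "A = B \<longleftrightarrow> A $ 1 $ 1 = B $ 1 $ 1 \<and> A $ 1 $ 2 = B $ 1 $ 2 \<and> A $ 2 $ 1 = B $ 2 $ 1 \<and> A $ 2 $ 2 = B $ 2 $ 2"
  by (auto simp: vec_eq_iff forall_2)

lemma mat2_mult_nth: "((A :: cmat2) ** B) $ i $ j = A $ i $ 1 * B $ 1 $ j + A $ i $ 2 * B $ 2 $ j"
  by (simp add: matrix_matrix_mult_def sum_2)

lemma matrix_add_rdistrib: "((B :: cmat2) + C) ** A = B ** A + C ** (A :: cmat2)"
  by (simp add: mat2_eq_iff mat2_mult_nth algebra_simps)

lemma su2_eq_iff [simp]: "su2 a b = su2 c d \<longleftrightarrow> a = c \<and> b = d"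
  by (auto simp: mat2_eq_iff)

lemma su2_mult: "su2 a b ** su2 c d = su2 (a * c - b * cnj d) (a * d + b * cnj c)"
  by (simp add: mat2_eq_iff mat2_mult_nth algebra_simps)

lemma su2_ctrans: "ctrans (su2 a b) = su2 (cnj a) (- b)"
  by (simp add: mat2_eq_iff ctrans_def)

lemma su2_one: "mat 1 = su2 1 0"
  by (simp add: mat2_eq_iff mat_def)

lemma su2_trace [simp]: "trace (su2 a b) = complex_of_real (2 * Re a)"
  by (simp add: trace_def sum_2 complex_add_cnj)

lemma su2_scaleR: "r *\<^sub>R su2 a b = su2 (r *\<^sub>R a) (r *\<^sub>R b)"
  by (simp add: mat2_eq_iff)

lemma su2_add: "su2 a b + su2 c d = su2 (a + c) (b + d)"
  by (simp add: mat2_eq_iff)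

lemma su2_diff: "su2 a b - su2 c d = su2 (a - c) (b - d)"
  by (simp add: mat2_eq_iff)

lemma su2_in_SU2_iff: "su2 a b \<in> SU2 \<longleftrightarrow> a * cnj a + b * cnj b = 1"
  by (auto simp: SU2_def su2_ctrans su2_mult su2_one det_2 mult.commute)

lemma SU2_cases:
  assumes "A \<in> SU2"
  obtains a b where "A = su2 a b" "a * cnj a + b * cnj b = 1"
proof -
  define a b c d where "a = A $ 1 $ 1" and "b = A $ 1 $ 2" and "c = A $ 2 $ 1" and "d = A $ 2 $ 2"
  note defs = a_def[symmetric] b_def[symmetric] c_def[symmetric] d_def[symmetric]
  have u: "A ** ctrans A = mat 1" and det: "det A = 1" using assms by (auto simp: SU2_def)
  have 1: "a * cnj a + b * cnj b = 1" and 2: "c * cnj a + d * cnj b = 0" and 3: "a * d - b * c = 1"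
    using u det by (auto simp: mat2_eq_iff mat2_mult_nth ctrans_def mat_def det_2 defs)
  have "d = d * (a * cnj a + b * cnj b)" using 1 by simp
  also have "\<dots> = (a * d - b * c) * cnj a + b * (c * cnj a + d * cnj b)" by (simp add: algebra_simps)
  finally have d: "d = cnj a" using 2 3 by simp
  have "c = c * (a * cnj a + b * cnj b)" using 1 by simp
  also have "\<dots> = a * (c * cnj a + d * cnj b) - (a * d - b * c) * cnj b" by (simp add: algebra_simps)
  finally have c: "c = - cnj b" using 2 3 by simp
  have "A = su2 a b" by (simp add: mat2_eq_iff defs c d)
  then show ?thesis using that 1 by blast
qed

lemma SU2_mult: "A \<in> SU2 \<Longrightarrow> B \<in> SU2 \<Longrightarrow> A ** B \<in> SU2"
proof (elim SU2_cases)
  fix a b c d assume *: "A = su2 a b" "B = su2 c d" "a * cnj a + b * cnj b = 1" "c * cnj c + d * cnj d = 1"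
  have "(a * c - b * cnj d) * cnj (a * c - b * cnj d) + (a * d + b * cnj c) * cnj (a * d + b * cnj c)
     = (a * cnj a + b * cnj b) * (c * cnj c + d * cnj d)" by (simp add: algebra_simps)
  then show ?thesis by (simp only: * su2_mult su2_in_SU2_iff mult_1)
qed

lemma SU2_one [simp]: "mat 1 \<in> SU2"
  by (simp add: su2_one su2_in_SU2_iff)

lemma SU2_ctrans: "A \<in> SU2 \<Longrightarrow> ctrans A \<in> SU2"
  by (elim SU2_cases) (simp add: su2_ctrans su2_in_SU2_iff mult.commute)

lemma ctrans_ctrans [simp]: "ctrans (ctrans A) = A"
  by (simp add: ctrans_def vec_eq_iff)

lemma SU2_mult_ctrans [simp]: "A \<in> SU2 \<Longrightarrow> A ** ctrans A = mat 1" "A \<in> SU2 \<Longrightarrow> ctrans A ** A = mat 1"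
  using SU2_ctrans[of A] by (auto simp: SU2_def)

lemma SU2_ctrans_eq: "A \<in> SU2 \<Longrightarrow> ctrans A = Re (trace A) *\<^sub>R mat 1 - A"
  by (elim SU2_cases) (simp add: su2_ctrans su2_one su2_scaleR su2_diff complex_eq_iff)

text \<open>The Cayley-Hamilton identity with determinant 1.\<close>

lemma SU2_square: "A \<in> SU2 \<Longrightarrow> A ** A = Re (trace A) *\<^sub>R A - mat 1"
proof (elim SU2_cases)
  fix a b assume *: "A = su2 a b" "a * cnj a + b * cnj b = 1"
  have "Re a * Re a + Im a * Im a + Re b * Re b + Im b * Im b = 1"
    using *(2) by (simp add: complex_eq_iff)
  then show ?thesis
    by (simp add: *(1) su2_mult su2_one su2_scaleR su2_diff complex_eq_iff algebra_simps)
qed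

text \<open>The polarised Cayley-Hamilton identity. Together with \<open>SU2_square\<close> it
  reduces every word in \<open>A\<close> and \<open>B\<close> to the span of \<open>mat 1\<close>,
  \<open>A\<close>, \<open>B\<close> and \<open>A ** B\<close>.\<close>

lemma SU2_swap:
  assumes "A \<in> SU2" "B \<in> SU2"
  shows "B ** A = (Re (trace (A ** B)) - Re (trace A) * Re (trace B)) *\<^sub>R mat 1
     + Re (trace B) *\<^sub>R A + Re (trace A) *\<^sub>R B - A ** B"
  using assms
proof (elim SU2_cases)
  fix a b c d assume *: "A = su2 a b" "B = su2 c d"
  show ?thesis
    by (simp add: * su2_mult su2_one su2_scaleR su2_diff su2_add complex_eq_iff algebra_simps)
qed

lemma SU2_trace_le: "A \<in> SU2 \<Longrightarrow> \<bar>Re (trace A)\<bar> \<le> 2"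
proof (elim SU2_cases)
  fix a b assume *: "A = su2 a b" "a * cnj a + b * cnj b = 1"
  then have "complex_of_real ((cmod a)\<^sup>2 + (cmod b)\<^sup>2) = 1"
    by (simp only: of_real_add complex_norm_square)
  then have "(cmod a)\<^sup>2 + (cmod b)\<^sup>2 = 1" by (simp only: of_real_eq_1_iff)
  then have "(cmod a)\<^sup>2 \<le> 1" using zero_le_power2[of "cmod b"] by linarith
  then have "cmod a \<le> 1" by (simp add: power_le_one_iff)
  then show ?thesis using abs_Re_le_cmod[of a] by (simp add: *)
qed

lemma gen_subgroup_SU2:
  assumes "A \<in> SU2" "B \<in> SU2" "C \<in> gen_subgroup A B"
  shows "C \<in> SU2"
  using assms(3) by induction (use assms in \<open>auto intro: SU2_mult SU2_ctrans\<close>)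

text \<open>After conjugation \<open>A\<close> is diagonal; the entry \<open>a\<close> of \<open>B\<close> is then determined by the traces of
  \<open>B\<close> and \<open>A ** B\<close>, and \<open>kappa \<le> 2\<close> says that its norm is at most \<open>1\<close>.\<close>

lemma SU2_with_global_coords:
  assumes x: "\<bar>x\<bar> \<le> 2" and y: "\<bar>y\<bar> \<le> 2" and k: "kappa (x, y, z) \<le> 2"
  shows "\<exists>A\<in>SU2. \<exists>B\<in>SU2. global_coords A B = (x, y, z)"
proof -
  define c s where "c = x / 2" and "s = sqrt (1 - c\<^sup>2)"
  have c: "c\<^sup>2 \<le> 1" using x by (simp add: c_def abs_square_le_1)
  have cs: "c\<^sup>2 + s\<^sup>2 = 1" using c by (simp add: s_def)
  have k': "4 * c\<^sup>2 + y\<^sup>2 + z\<^sup>2 - 2 * c * y * z \<le> 4"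
    using k by (simp add: kappa_def c_def power2_eq_square)
  \<comment> \<open>\<open>v\<close> will be the imaginary part of the diagonal entry of
    \<open>B\<close>. If \<open>s = 0\<close>, then \<open>A\<close> is plus or minus the identity,
    and the bound on \<open>kappa\<close> forces \<open>z = c * y\<close>.\<close>
  obtain v where v: "c * y - 2 * s * v = z" "(y / 2)\<^sup>2 + v\<^sup>2 \<le> 1"
  proof (cases "s = 0")
    case True
    then have c1: "c\<^sup>2 = 1" using cs by simp
    have "(c * y - z)\<^sup>2 = c\<^sup>2 * y\<^sup>2 + z\<^sup>2 - 2 * c * y * z" by (simp add: power2_eq_square algebra_simps)
    then have "(c * y - z)\<^sup>2 \<le> 0" using k' c1 by simp
    then have "c * y = z" by simp
    moreover have "(y / 2)\<^sup>2 \<le> 1" using y by (simp add: abs_square_le_1)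
    ultimately show ?thesis using True that[of 0] by simp
  next
    case False
    define v where "v = (c * y - z) / (2 * s)"
    have sv: "2 * s * v = c * y - z" using False by (simp add: v_def)
    have "4 * s\<^sup>2 * ((y / 2)\<^sup>2 + v\<^sup>2) = s\<^sup>2 * y\<^sup>2 + (2 * s * v)\<^sup>2"
      by (simp add: power2_eq_square algebra_simps)
    also have "\<dots> = (c\<^sup>2 + s\<^sup>2) * y\<^sup>2 + z\<^sup>2 - 2 * c * y * z"
      unfolding sv by (simp add: power2_eq_square algebra_simps)
    also have "\<dots> = y\<^sup>2 + z\<^sup>2 - 2 * c * y * z" unfolding cs by simp
    also have "\<dots> \<le> 4 * s\<^sup>2 * 1" using k' cs by simp
    finally have "(y / 2)\<^sup>2 + v\<^sup>2 \<le> 1" using False by (simp add: mult_le_cancel_left_pos)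
    then show ?thesis using sv that[of v] by simp
  qed
  define a where "a = Complex (y / 2) v"
  define b where "b = complex_of_real (sqrt (1 - (cmod a)\<^sup>2))"
  have ca: "(cmod a)\<^sup>2 \<le> 1" using v(2) by (simp add: a_def cmod_power2)
  have "a * cnj a + b * cnj b = 1"
    using ca by (simp add: b_def complex_norm_square[symmetric] flip: of_real_mult of_real_power of_real_add)
  then have "su2 a b \<in> SU2" by (simp add: su2_in_SU2_iff)
  moreover have "su2 (Complex c s) 0 \<in> SU2"
    using cs by (simp add: su2_in_SU2_iff complex_eq_iff power2_eq_square)
  moreover have "global_coords (su2 (Complex c s) 0) (su2 a b) = (x, y, z)"
    using v(1) by (simp add: global_coords_def su2_mult a_def c_def algebra_simps)
  ultimately show ?thesis by blast
qed

text \<open>Fricke's identity for the trace of a commutator. In real and imaginary parts it is a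
  polynomial identity modulo the two norm equations.\<close>

lemma kappa_global_coords:
  assumes "A \<in> SU2" "B \<in> SU2"
  shows "kappa (global_coords A B) = Re (trace (A ** B ** ctrans A ** ctrans B))"
  using assms
proof (elim SU2_cases)
  fix a b c d assume *: "A = su2 a b" "B = su2 c d" "a * cnj a + b * cnj b = 1" "c * cnj c + d * cnj d = 1"
  have 1: "(Re a)\<^sup>2 + (Im a)\<^sup>2 + (Re b)\<^sup>2 + (Im b)\<^sup>2 = 1" "(Re c)\<^sup>2 + (Im c)\<^sup>2 + (Re d)\<^sup>2 + (Im d)\<^sup>2 = 1"
    using *(3,4) by (auto simp: complex_eq_iff power2_eq_square)
  then show ?thesis
    apply (simp add: * kappa_def global_coords_def su2_mult su2_ctrans)
    by algebra
qed

section \<open>Obstructions to density\<close>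

lemma SU2_cancel [simp]:
  assumes "A \<in> SU2"
  shows "A ** (ctrans A ** X) = X" "ctrans A ** (A ** X) = X"
  using assms by (simp_all add: matrix_mul_assoc)

lemma SU2_cancel_right [simp]:
  assumes "A \<in> SU2"
  shows "X ** A ** ctrans A = X" "X ** ctrans A ** A = X"
  using assms by (simp_all flip: matrix_mul_assoc)

text \<open>Conjugation of \<open>A\<close> to \<open>X\<close> by \<open>D\<close> and of
  \<open>X\<close> to \<open>Y\<close> by \<open>C\<close>, written without inverses.\<close>

lemma intertwine_mult:
  fixes A :: cmat2
  assumes "D ** A = X ** D" "C ** X = Y ** C"
  shows "(C ** D) ** A = Y ** (C ** D)"
  using assms by (metis matrix_mul_assoc)

lemma intertwine_ctrans:
  assumes "C \<in> SU2" "X ** C = C ** Y"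
  shows "ctrans C ** X = Y ** ctrans C"
proof -
  have "ctrans C ** X = ctrans C ** (X ** C) ** ctrans C"
    using assms(1) by (simp add: matrix_mul_assoc)
  also have "\<dots> = Y ** ctrans C" using assms by simp
  finally show ?thesis .
qed

lemma continuous_mult_left: "continuous_on S (\<lambda>C :: cmat2. A ** C)"
  and continuous_mult_right: "continuous_on S (\<lambda>C :: cmat2. C ** A)"
  and continuous_Re_trace: "continuous_on S (\<lambda>C :: cmat2. Re (trace C))"
  by (intro linear_continuous_on linear_conv_bounded_linear[THEN iffD1] linearI;
      simp add: matrix_add_ldistrib matrix_add_rdistrib matrix_scalar_ac scalar_matrix_assoc
        trace_def sum_2 algebra_simps)+

lemma dense_subgroup_closed:
  assumes "SU2 \<subseteq> closure (gen_subgroup A B)" "gen_subgroup A B \<subseteq> S" "closed S"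
  shows "SU2 \<subseteq> S"
  using assms closure_minimal by blast

text \<open>The trace is continuous, so limits of group elements have traces in the finite, hence
  closed, set \<open>T\<close>, whereas the traces on SU(2) fill an interval.\<close>

lemma finite_traces_not_dense:
  assumes "finite T" "\<And>C. C \<in> gen_subgroup A B \<Longrightarrow> Re (trace C) \<in> T"
  shows "\<not> SU2 \<subseteq> closure (gen_subgroup A B)"
proof
  assume d: "SU2 \<subseteq> closure (gen_subgroup A B)"
  have "closed ((\<lambda>C :: cmat2. Re (trace C)) -` T)"
    by (intro continuous_closed_vimage continuous_on_imp_continuous_within finite_imp_closed assms)
       (use continuous_Re_trace in \<open>auto simp: continuous_on_eq_continuous_at\<close>)
  from dense_subgroup_closed[OF d _ this] assms(2) have T: "Re (trace C) \<in> T" if "C \<in> SU2" for C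
    using that by blast
  have "{0..1} \<subseteq> (\<lambda>t. t / 2) ` T"
  proof
    fix c :: real assume "c \<in> {0..1}"
    then have "c\<^sup>2 \<le> 1" by (simp add: power_le_one)
    then have "su2 (of_real c) (of_real (sqrt (1 - c\<^sup>2))) \<in> SU2"
      by (simp add: su2_in_SU2_iff complex_eq_iff power2_eq_square[symmetric])
    from T[OF this] have "2 * c \<in> T" by simp
    then show "c \<in> (\<lambda>t. t / 2) ` T" by (rule rev_image_eqI) simp
  qed
  then have "finite {0..1::real}" using assms(1) finite_surj by blast
  then show False using infinite_Icc[of "0::real" 1] by simp
qed

lemma commutes_all_imp_sign:
  assumes A: "A \<in> SU2" and c: "\<And>C. C \<in> SU2 \<Longrightarrow> C ** A = A ** C"
  shows "A = mat 1 \<or> A = - mat 1"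
proof -
  obtain a b where ab: "A = su2 a b" "a * cnj a + b * cnj b = 1" using A SU2_cases by metis
  have "b = 0" using c[of "su2 \<i> 0"] by (simp add: su2_in_SU2_iff ab su2_mult complex_eq_iff)
  moreover have "Im a = 0" using c[of "su2 0 1"] by (simp add: su2_in_SU2_iff ab su2_mult complex_eq_iff)
  ultimately have "a = 1 \<or> a = - 1" using ab(2)
    by (auto simp: complex_eq_iff square_eq_1_iff)
  then show ?thesis using \<open>b = 0\<close> by (auto simp: ab mat2_eq_iff mat_def)
qed

text \<open>Commuting with both generators is inherited by the group and its closure. Density would
  make \<open>A\<close> and \<open>B\<close> central, that is plus or minus the identity, and leave
  only the traces 2 and -2.\<close>

lemma commuting_not_dense:
  assumes S: "A \<in> SU2" "B \<in> SU2" and AB: "A ** B = B ** A"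
  shows "\<not> SU2 \<subseteq> closure (gen_subgroup A B)"
proof
  assume d: "SU2 \<subseteq> closure (gen_subgroup A B)"
  have central: "X = mat 1 \<or> X = - mat 1" if X: "X \<in> SU2" "X ** A = A ** X" "X ** B = B ** X" for X
  proof -
    have "C ** X = X ** C" if "C \<in> gen_subgroup A B" for C
      using that
    proof induction
      case (mult C D)
      then show ?case by (intro intertwine_mult)
    next
      case (inv C)
      then have "C \<in> SU2" using S gen_subgroup_SU2 by blast
      then show ?case using inv.IH by (intro intertwine_ctrans) auto
    qed (use X in simp_all)
    moreover have "closed {C :: cmat2. C ** X = X ** C}"
      by (intro closed_Collect_eq continuous_mult_left continuous_mult_right)
    ultimately have "SU2 \<subseteq> {C. C ** X = X ** C}"
      by (intro dense_subgroup_closed[OF d]) auto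
    then show ?thesis using commutes_all_imp_sign[OF X(1)] by blast
  qed
  have sg: "A = mat 1 \<or> A = - mat 1" "B = mat 1 \<or> B = - mat 1"
    using central[of A] central[of B] S AB by auto
  have [simp]: "ctrans (mat 1) = mat 1" "ctrans (- mat 1) = - mat 1" "(- mat 1 :: cmat2) ** - mat 1 = mat 1"
    "(- mat 1 :: cmat2) ** mat 1 = - mat 1"
    by (auto simp: mat2_eq_iff mat2_mult_nth ctrans_def mat_def)
  have pm: "C = mat 1 \<or> C = - mat 1" if "C \<in> gen_subgroup A B" for C
    using that by induction (use sg in auto)
  then have "Re (trace C) \<in> {2, -2}" if "C \<in> gen_subgroup A B" for C
    using pm[OF that]
    by (elim disjE) (simp_all add: trace_def sum_2 mat_def)
  from finite_traces_not_dense[OF _ this] d show False by auto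
qed

text \<open>Here \<open>B ** A ** ctrans B = ctrans A\<close>, so that conjugation by any element of the group
  sends \<open>A\<close> to \<open>A\<close> or to its inverse.\<close>

lemma dihedral_not_dense:
  assumes S: "A \<in> SU2" "B \<in> SU2" and tr: "Re (trace B) = 0" "Re (trace (A ** B)) = 0"
  shows "\<not> SU2 \<subseteq> closure (gen_subgroup A B)"
proof
  assume d: "SU2 \<subseteq> closure (gen_subgroup A B)"
  define P where "P C \<longleftrightarrow> C ** A = A ** C \<or> C ** A = ctrans A ** C" for C
  have "B ** A = Re (trace A) *\<^sub>R B - A ** B" using SU2_swap[OF S] tr by simp
  also have "\<dots> = ctrans A ** B"
    using S by (simp add: SU2_ctrans_eq[of A] mat2_eq_iff mat2_mult_nth mat_def algebra_simps)
  finally have PB: "P B" by (simp add: P_def)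
  have inv_side: "C ** ctrans A = ctrans A ** C" if "C ** A = A ** C" for C
    using intertwine_ctrans[OF S(1)] that by metis
  have inv_side': "C ** ctrans A = A ** C" if "C ** A = ctrans A ** C" for C
  proof -
    have "C ** ctrans A = A ** (ctrans A ** C) ** ctrans A" using S by simp
    also have "\<dots> = A ** C" using S by (simp flip: that add: matrix_mul_assoc)
    finally show ?thesis .
  qed
  have "P C" if "C \<in> gen_subgroup A B" for C
    using that
  proof induction
    case (mult C D)
    note i = intertwine_mult[of D A _ C]
    from mult.IH i[of A] i[of "ctrans A"] inv_side[of C] inv_side'[of C]
    show ?case unfolding P_def by blast
  next
    case (inv C)
    then have "C \<in> SU2" using S gen_subgroup_SU2 by blast
    then have *: "ctrans C ** X = Y ** ctrans C" if "X ** C = C ** Y" for X Y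
      using intertwine_ctrans that by blast
    show ?case
      using inv.IH *[of A A] *[of A "ctrans A"] inv_side'[of C] unfolding P_def by auto
  qed (use PB in \<open>auto simp: P_def\<close>)
  moreover have "closed {C. P C}"
    unfolding P_def by (intro closed_Collect_disj closed_Collect_eq continuous_mult_left continuous_mult_right)
  ultimately have "SU2 \<subseteq> {C. P C}"
    by (intro dense_subgroup_closed[OF d]) auto
  then have PS: "P C" if "C \<in> SU2" for C using that by blast
  obtain a b where ab: "A = su2 a b" "a * cnj a + b * cnj b = 1" using S SU2_cases by metis
  \<comment> \<open>Both the real and the imaginary part are nonzero, so either alternative of
    \<open>P\<close> forces \<open>b = 0\<close>. In the next test element both entries are nonzero,
    so either alternative forces \<open>a\<close> to be real.\<close>
  have "P (su2 (Complex (3/5) (4/5)) 0)" by (intro PS) (simp add: su2_in_SU2_iff complex_eq_iff)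
  then have b: "b = 0" by (auto simp: P_def ab su2_mult su2_ctrans complex_eq_iff)
  have "P (su2 (Complex (3/5) 0) (Complex (4/5) 0))" by (intro PS) (simp add: su2_in_SU2_iff complex_eq_iff)
  then have "Im a = 0" by (auto simp: P_def ab b su2_mult su2_ctrans complex_eq_iff)
  then have "A ** B = B ** A"
    using S by (elim SU2_cases[of B]) (simp add: ab b su2_mult complex_eq_iff)
  then show False using commuting_not_dense[OF S] d by blast
qed

text \<open>The commutator has trace 2, and the only such element of SU(2) is the identity.\<close>

lemma kappa_2_not_dense:
  assumes S: "A \<in> SU2" "B \<in> SU2" and k: "kappa (global_coords A B) = 2"
  shows "\<not> SU2 \<subseteq> closure (gen_subgroup A B)"
proof -
  define K where "K = A ** B ** ctrans A ** ctrans B"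
  have K: "K \<in> SU2" using S by (auto simp: K_def intro: SU2_mult SU2_ctrans)
  have "Re (trace K) = 2" using k kappa_global_coords[OF S] by (simp add: K_def)
  then have "K = mat 1"
    using K
  proof (elim SU2_cases)
    fix a b assume *: "K = su2 a b" "a * cnj a + b * cnj b = 1" "Re (trace K) = 2"
    then have "Re a = 1" by simp
    then have "Im a * Im a + Re b * Re b + Im b * Im b = 0" using *(2) by (simp add: complex_eq_iff)
    then have "Im a = 0" "Re b = 0" "Im b = 0"
      by (smt (verit) mult_eq_0_iff zero_le_square)+
    then show ?thesis using \<open>Re a = 1\<close> by (simp add: * su2_one complex_eq_iff)
  qed
  then have "A ** B = B ** A"
  proof -
    have "K ** (B ** A) = A ** B"
      unfolding K_def using S by (simp flip: matrix_mul_assoc)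
    then show ?thesis using \<open>K = mat 1\<close> by simp
  qed
  then show ?thesis using commuting_not_dense[OF S] by blast
qed

section \<open>Families of matrices over a ring of functions\<close>

text \<open>Closure under these pointwise operations is all that \<open>trace_family\<close> and
  \<open>Gamma_orbit_family\<close> use of \<open>int_values z\<close>.\<close>

definition real_subring :: "('i \<Rightarrow> real) set \<Rightarrow> bool" where
  "real_subring U \<longleftrightarrow> (\<lambda>w. 0) \<in> U \<and> (\<lambda>w. 1) \<in> U \<and>
     (\<forall>u\<in>U. \<forall>v\<in>U. (\<lambda>w. u w + v w) \<in> U \<and> (\<lambda>w. u w - v w) \<in> U \<and> (\<lambda>w. u w * v w) \<in> U)"

lemma real_subringD:
  assumes "real_subring U"
  shows "(\<lambda>w. 0) \<in> U" "(\<lambda>w. 1) \<in> U"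
    "u \<in> U \<Longrightarrow> v \<in> U \<Longrightarrow> (\<lambda>w. u w + v w) \<in> U"
    "u \<in> U \<Longrightarrow> v \<in> U \<Longrightarrow> (\<lambda>w. u w - v w) \<in> U"
    "u \<in> U \<Longrightarrow> v \<in> U \<Longrightarrow> (\<lambda>w. u w * v w) \<in> U"
  using assms unfolding real_subring_def by blast+

definition comb :: "cmat2 \<Rightarrow> cmat2 \<Rightarrow> real \<Rightarrow> real \<Rightarrow> real \<Rightarrow> real \<Rightarrow> cmat2" where
  "comb A B p q r s = p *\<^sub>R mat 1 + q *\<^sub>R A + r *\<^sub>R B + s *\<^sub>R (A ** B)"

lemma matrix_diff_rdistrib: "((B :: cmat2) - C) ** A = B ** A - C ** (A :: cmat2)"
  and matrix_diff_ldistrib: "(A :: cmat2) ** (B - C) = A ** B - A ** C"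
  by (simp_all add: mat2_eq_iff mat2_mult_nth algebra_simps)

lemma scaleR_mult_left: "(c *\<^sub>R (A :: cmat2)) ** (B :: cmat2) = c *\<^sub>R (A ** B)"
  and scaleR_mult_right: "(A :: cmat2) ** (c *\<^sub>R (B :: cmat2)) = c *\<^sub>R (A ** B)"
  by (simp_all add: mat2_eq_iff mat2_mult_nth algebra_simps)

lemmas mat2_distribs = matrix_add_ldistrib matrix_add_rdistrib matrix_diff_ldistrib
  matrix_diff_rdistrib scaleR_mult_left scaleR_mult_right

lemma comb_add: "comb A B p q r s + comb A B p' q' r' s' = comb A B (p + p') (q + q') (r + r') (s + s')"
  by (simp add: comb_def algebra_simps)

lemma comb_scale: "c *\<^sub>R comb A B p q r s = comb A B (c * p) (c * q) (c * r) (c * s)"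
  by (simp add: comb_def algebra_simps)

lemma comb_mult_left:
  "comb A B p q r s ** M = p *\<^sub>R M + q *\<^sub>R (A ** M) + r *\<^sub>R (B ** M) + s *\<^sub>R (A ** (B ** M))"
  for M :: cmat2
  by (simp add: comb_def mat2_distribs matrix_mul_assoc)

text \<open>Left multiplication by the two generators is enough: \<open>comb_mult_left\<close>
  builds every product from it.\<close>

lemma comb_mult_A:
  assumes "A \<in> SU2" "global_coords A B = (x, y, z)"
  shows "A ** comb A B p q r s = comb A B (- q) (p + x * q) (- s) (r + x * s)"
proof -
  have 1: "A ** A = x *\<^sub>R A - mat 1" using SU2_square[OF assms(1)] assms(2) by (simp add: global_coords_def)
  have 2: "A ** (A ** B) = x *\<^sub>R (A ** B) - B"
    unfolding matrix_mul_assoc 1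
    by (simp add: mat2_distribs)
  show ?thesis
    by (simp add: comb_def mat2_distribs 1 2 algebra_simps)
qed

lemma comb_mult_B:
  assumes S: "A \<in> SU2" "B \<in> SU2" and c: "global_coords A B = (x, y, z)"
  shows "B ** comb A B p q r s
     = comb A B (q * (z - x * y) - r - x * s) (y * q + s) (p + x * q + y * r + z * s) (- q)"
proof -
  have 1: "B ** B = y *\<^sub>R B - mat 1" using SU2_square[OF S(2)] c by (simp add: global_coords_def)
  have 2: "B ** A = (z - x * y) *\<^sub>R mat 1 + y *\<^sub>R A + x *\<^sub>R B - A ** B"
    using SU2_swap[OF S] c by (simp add: global_coords_def)
  have 3: "B ** (A ** B) = z *\<^sub>R B - x *\<^sub>R mat 1 + A"
  proof -
    have "B ** (A ** B) = (z - x * y) *\<^sub>R B + y *\<^sub>R (A ** B) + x *\<^sub>R (B ** B) - A ** (B ** B)"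
      unfolding matrix_mul_assoc 2
      by (simp add: mat2_distribs matrix_mul_assoc)
    also have "A ** (B ** B) = y *\<^sub>R (A ** B) - A"
      unfolding 1 by (simp add: mat2_distribs)
    finally show ?thesis unfolding 1 by (simp add: algebra_simps)
  qed
  show ?thesis
    by (simp add: comb_def mat2_distribs 1 2 3 algebra_simps)
qed

text \<open>The matrices \<open>1, A, B, A ** B\<close> span over \<open>U\<close> an algebra containing the group,
  with structure constants that are polynomials in the global coordinates.
  Hence the group elements can be carried along a family of pairs with coordinates in \<open>U\<close>.\<close>

lemma trace_family:
  fixes \<alpha> \<beta> :: "'i \<Rightarrow> cmat2"
  assumes U: "real_subring U"
    and S: "\<And>w. w \<in> G \<Longrightarrow> \<alpha> w \<in> SU2" "\<And>w. w \<in> G \<Longrightarrow> \<beta> w \<in> SU2"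
    and xyz: "x \<in> U" "y \<in> U" "z \<in> U"
    and coords: "\<And>w. w \<in> G \<Longrightarrow> global_coords (\<alpha> w) (\<beta> w) = (x w, y w, z w)"
    and g: "g \<in> G" and C: "C \<in> gen_subgroup (\<alpha> g) (\<beta> g)"
  shows "\<exists>t\<in>U. t g = Re (trace C) \<and> (\<forall>w\<in>G. \<bar>t w\<bar> \<le> 2)"
proof -
  note R = real_subringD[OF U]
  have neg: "(\<lambda>w. - u w) \<in> U" if "u \<in> U" for u using R(4)[OF R(1) that] by simp
  define V where "V = {M. \<exists>p\<in>U. \<exists>q\<in>U. \<exists>r\<in>U. \<exists>s\<in>U. \<forall>w\<in>G. M w = comb (\<alpha> w) (\<beta> w) (p w) (q w) (r w) (s w)}"
  have VI: "M \<in> V" if "p \<in> U" "q \<in> U" "r \<in> U" "s \<in> U"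
    "\<And>w. w \<in> G \<Longrightarrow> M w = comb (\<alpha> w) (\<beta> w) (p w) (q w) (r w) (s w)" for M p q r s
    using that unfolding V_def by blast
  have VE: "\<exists>p q r s. p \<in> U \<and> q \<in> U \<and> r \<in> U \<and> s \<in> U \<and>
    (\<forall>w\<in>G. M w = comb (\<alpha> w) (\<beta> w) (p w) (q w) (r w) (s w))" if "M \<in> V" for M
    using that unfolding V_def by blast
  have Vadd: "(\<lambda>w. M w + N w) \<in> V" if MN: "M \<in> V" "N \<in> V" for M N
  proof -
    obtain p q r s p' q' r' s' where
      "p \<in> U" "q \<in> U" "r \<in> U" "s \<in> U" "\<forall>w\<in>G. M w = comb (\<alpha> w) (\<beta> w) (p w) (q w) (r w) (s w)"
      "p' \<in> U" "q' \<in> U" "r' \<in> U" "s' \<in> U" "\<forall>w\<in>G. N w = comb (\<alpha> w) (\<beta> w) (p' w) (q' w) (r' w) (s' w)"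
      using VE[OF MN(1)] VE[OF MN(2)] by blast
    then show ?thesis
      by (intro VI[of "\<lambda>w. p w + p' w" "\<lambda>w. q w + q' w" "\<lambda>w. r w + r' w" "\<lambda>w. s w + s' w"] R(3))
         (auto simp: comb_add)
  qed
  have Vscale: "(\<lambda>w. c w *\<^sub>R M w) \<in> V" if c: "c \<in> U" and M: "M \<in> V" for c M
  proof -
    obtain p q r s where
      "p \<in> U" "q \<in> U" "r \<in> U" "s \<in> U" "\<forall>w\<in>G. M w = comb (\<alpha> w) (\<beta> w) (p w) (q w) (r w) (s w)"
      using VE[OF M] by blast
    then show ?thesis using c
      by (intro VI[of "\<lambda>w. c w * p w" "\<lambda>w. c w * q w" "\<lambda>w. c w * r w" "\<lambda>w. c w * s w"] R(5))
         (auto simp: comb_scale)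
  qed
  have V1: "(\<lambda>w. mat 1) \<in> V"
    by (intro VI[of "\<lambda>w. 1" "\<lambda>w. 0" "\<lambda>w. 0" "\<lambda>w. 0"] R(1,2)) (simp add: comb_def)
  have VA: "\<alpha> \<in> V"
    by (intro VI[of "\<lambda>w. 0" "\<lambda>w. 1" "\<lambda>w. 0" "\<lambda>w. 0"] R(1,2)) (simp add: comb_def)
  have VB: "\<beta> \<in> V"
    by (intro VI[of "\<lambda>w. 0" "\<lambda>w. 0" "\<lambda>w. 1" "\<lambda>w. 0"] R(1,2)) (simp add: comb_def)
  have VmA: "(\<lambda>w. \<alpha> w ** M w) \<in> V" if M: "M \<in> V" for M
  proof -
    obtain p q r s where
      "p \<in> U" "q \<in> U" "r \<in> U" "s \<in> U" "\<forall>w\<in>G. M w = comb (\<alpha> w) (\<beta> w) (p w) (q w) (r w) (s w)"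
      using VE[OF M] by blast
    then show ?thesis using xyz
      by (intro VI[of "\<lambda>w. - q w" "\<lambda>w. p w + x w * q w" "\<lambda>w. - s w" "\<lambda>w. r w + x w * s w"] R(3-5) neg)
         (auto simp: comb_mult_A[OF S(1) coords])
  qed
  have VmB: "(\<lambda>w. \<beta> w ** M w) \<in> V" if M: "M \<in> V" for M
  proof -
    obtain p q r s where
      "p \<in> U" "q \<in> U" "r \<in> U" "s \<in> U" "\<forall>w\<in>G. M w = comb (\<alpha> w) (\<beta> w) (p w) (q w) (r w) (s w)"
      using VE[OF M] by blast
    then show ?thesis using xyz
      by (intro VI[of "\<lambda>w. q w * (z w - x w * y w) - r w - x w * s w" "\<lambda>w. y w * q w + s w"
            "\<lambda>w. p w + x w * q w + y w * r w + z w * s w" "\<lambda>w. - q w"] R(3-5) neg)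
         (auto simp: comb_mult_B[OF S coords])
  qed
  have Vmult: "(\<lambda>w. M w ** N w) \<in> V" if M: "M \<in> V" and N: "N \<in> V" for M N
  proof -
    obtain p q r s where M':
      "p \<in> U" "q \<in> U" "r \<in> U" "s \<in> U" "\<forall>w\<in>G. M w = comb (\<alpha> w) (\<beta> w) (p w) (q w) (r w) (s w)"
      using VE[OF M] by blast
    have "(\<lambda>w. p w *\<^sub>R N w + q w *\<^sub>R (\<alpha> w ** N w) + r w *\<^sub>R (\<beta> w ** N w)
        + s w *\<^sub>R (\<alpha> w ** (\<beta> w ** N w))) \<in> V" (is "?L \<in> V")
      using M' N by (intro Vadd Vscale VmA VmB)
    then obtain p' q' r' s' where
      "p' \<in> U" "q' \<in> U" "r' \<in> U" "s' \<in> U" "\<forall>w\<in>G. ?L w = comb (\<alpha> w) (\<beta> w) (p' w) (q' w) (r' w) (s' w)"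
      using VE by blast
    then show ?thesis using M'(5)
      by (intro VI[of p' q' r' s']) (auto simp: comb_mult_left)
  qed
  have Vtrace: "\<exists>t\<in>U. \<forall>w\<in>G. t w = Re (trace (M w))" if M: "M \<in> V" for M
  proof -
    obtain p q r s where M':
      "p \<in> U" "q \<in> U" "r \<in> U" "s \<in> U" "\<forall>w\<in>G. M w = comb (\<alpha> w) (\<beta> w) (p w) (q w) (r w) (s w)"
      using VE[OF M] by blast
    have "Re (trace (M w)) = p w + p w + q w * x w + r w * y w + s w * z w" if "w \<in> G" for w
    proof -
      have "x w = Re (trace (\<alpha> w))" "y w = Re (trace (\<beta> w))" "z w = Re (trace (\<alpha> w ** \<beta> w))"
        using coords[OF that] by (simp_all add: global_coords_def)
      then show ?thesis
        using M'(5) that by (simp add: comb_def trace_def sum_2 mat_def algebra_simps)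
    qed
    moreover have "(\<lambda>w. p w + p w + q w * x w + r w * y w + s w * z w) \<in> U"
      using M' xyz by (intro R(3,5))
    ultimately show ?thesis by (intro bexI[of _ "\<lambda>w. p w + p w + q w * x w + r w * y w + s w * z w"]) auto
  qed
  \<comment> \<open>On SU(2) the inverse is the trace minus the matrix, hence linear in the
    coefficients once the trace is in \<open>U\<close>. For this the induction below carries along
    that \<open>M w\<close> lies in \<open>SU2\<close> for every \<open>w\<close>.\<close>
  have Vctrans: "(\<lambda>w. ctrans (M w)) \<in> V" if M: "M \<in> V" and MS: "\<forall>w\<in>G. M w \<in> SU2" for M
  proof -
    obtain t where t: "t \<in> U" "\<forall>w\<in>G. t w = Re (trace (M w))" using Vtrace[OF M] by blast
    obtain p q r s where M':
      "p \<in> U" "q \<in> U" "r \<in> U" "s \<in> U" "\<forall>w\<in>G. M w = comb (\<alpha> w) (\<beta> w) (p w) (q w) (r w) (s w)"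
      using VE[OF M] by blast
    have "ctrans (M w) = comb (\<alpha> w) (\<beta> w) (t w - p w) (- q w) (- r w) (- s w)" if "w \<in> G" for w
    proof -
      have "ctrans (M w) = t w *\<^sub>R mat 1 - M w" using SU2_ctrans_eq t MS that by auto
      then show ?thesis using M'(5) that by (auto simp: comb_def algebra_simps)
    qed
    then show ?thesis using M' t
      by (intro VI[of "\<lambda>w. t w - p w" "\<lambda>w. - q w" "\<lambda>w. - r w" "\<lambda>w. - s w"] R(4) neg)
  qed
  have "\<exists>M\<in>V. M g = C \<and> (\<forall>w\<in>G. M w \<in> SU2)"
    using C
  proof induction
    case one
    then show ?case using V1 by (intro bexI[of _ "\<lambda>w. mat 1"]) auto
  next
    case genA
    then show ?case using VA S by (intro bexI[of _ \<alpha>]) auto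
  next
    case genB
    then show ?case using VB S by (intro bexI[of _ \<beta>]) auto
  next
    case (mult C D)
    then obtain M N where "M \<in> V" "M g = C" "\<forall>w\<in>G. M w \<in> SU2" "N \<in> V" "N g = D" "\<forall>w\<in>G. N w \<in> SU2"
      by blast
    then show ?case using Vmult by (intro bexI[of _ "\<lambda>w. M w ** N w"]) (auto intro: SU2_mult)
  next
    case (inv C)
    then obtain M where "M \<in> V" "M g = C" "\<forall>w\<in>G. M w \<in> SU2" by blast
    then show ?case using Vctrans by (intro bexI[of _ "\<lambda>w. ctrans (M w)"]) (auto intro: SU2_ctrans)
  qed
  then obtain M where M: "M \<in> V" "M g = C" "\<forall>w\<in>G. M w \<in> SU2" by blast
  obtain t where "t \<in> U" "\<forall>w\<in>G. t w = Re (trace (M w))" using Vtrace[OF M(1)] by blast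
  then show ?thesis using M g SU2_trace_le by auto
qed

lemma real_subring_int_values: "real_subring (int_values z)"
  unfolding real_subring_def
  by (auto intro: int_values_const int_values_add int_values_diff int_values_mult)

text \<open>The twists are integer polynomial maps, so the word leading to \<open>q\<close> can be
  applied to the coordinate functions themselves. This compares the orbit at any conjugate
  \<open>w\<close> with the orbit at \<open>g\<close>, where the angles are known to be
  rational.\<close>

lemma Gamma_orbit_family:
  assumes U: "real_subring U" and "x \<in> U" "y \<in> U" "z \<in> U"
    and q: "q \<in> Gamma_orbit (x w, y w, z w)"
  shows "\<exists>a\<in>U. \<exists>b\<in>U. \<exists>c\<in>U. q = (a w, b w, c w) \<and> (a g, b g, c g) \<in> Gamma_orbit (x g, y g, z g)"
  using q
proof induction
  case base
  then show ?case using assms Gamma_orbit.base by blast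
next
  note R = real_subringD[OF U]
  case (tX q)
  then obtain a b c where *: "a \<in> U" "b \<in> U" "c \<in> U" "q = (a w, b w, c w)"
    "(a g, b g, c g) \<in> Gamma_orbit (x g, y g, z g)" by blast
  then have "(\<lambda>w. a w * c w - b w) \<in> U" by (intro R(4,5))
  then show ?case using * Gamma_orbit.tX[OF *(5)]
    by (intro bexI[of _ a] bexI[of _ c] bexI[of _ "\<lambda>w. a w * c w - b w"]) (auto simp: tauX_def)
next
  note R = real_subringD[OF U]
  case (tY q)
  then obtain a b c where *: "a \<in> U" "b \<in> U" "c \<in> U" "q = (a w, b w, c w)"
    "(a g, b g, c g) \<in> Gamma_orbit (x g, y g, z g)" by blast
  then have "(\<lambda>w. b w * c w - a w) \<in> U" by (intro R(4,5))
  then show ?case using * Gamma_orbit.tY[OF *(5)]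
    by (intro bexI[of _ c] bexI[of _ b] bexI[of _ "\<lambda>w. b w * c w - a w"]) (auto simp: tauY_def)
next
  note R = real_subringD[OF U]
  case (tXi q)
  then obtain a b c where *: "a \<in> U" "b \<in> U" "c \<in> U" "q = (a w, b w, c w)"
    "(a g, b g, c g) \<in> Gamma_orbit (x g, y g, z g)" by blast
  then have "(\<lambda>w. a w * b w - c w) \<in> U" by (intro R(4,5))
  then show ?case using * Gamma_orbit.tXi[OF *(5)]
    by (intro bexI[of _ a] bexI[of _ "\<lambda>w. a w * b w - c w"] bexI[of _ b]) (auto simp: tauX_inv_def)
next
  note R = real_subringD[OF U]
  case (tYi q)
  then obtain a b c where *: "a \<in> U" "b \<in> U" "c \<in> U" "q = (a w, b w, c w)"
    "(a g, b g, c g) \<in> Gamma_orbit (x g, y g, z g)" by blast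
  then have "(\<lambda>w. b w * a w - c w) \<in> U" by (intro R(4,5))
  then show ?case using * Gamma_orbit.tYi[OF *(5)]
    by (intro bexI[of _ "\<lambda>w. b w * a w - c w"] bexI[of _ b] bexI[of _ a]) (auto simp: tauY_inv_def)
qed

section \<open>Orbits with rational angles only\<close>

lemma rational_orbit_not_dense:
  assumes S: "A \<in> SU2" "B \<in> SU2"
    and rat: "\<And>x y z. (x, y, z) \<in> Gamma_orbit (global_coords A B) \<Longrightarrow>
      rational_angle x \<and> rational_angle y \<and> rational_angle z"
  shows "\<not> SU2 \<subseteq> closure (gen_subgroup A B)"
proof -
  obtain x0 y0 z0 where p: "global_coords A B = (x0, y0, z0)" by (cases "global_coords A B") auto
  have "rational_angle x0" "rational_angle y0" "rational_angle z0"
    using rat[of x0 y0 z0] Gamma_orbit.base[of "global_coords A B"] p by auto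
  from this[THEN rational_angle_unity] obtain l m n where lmn: "l > 0" "m > 0" "n > 0"
    and ex: "\<forall>N>0. l dvd N \<longrightarrow> (\<exists>a. x0 = 2 * Re (cis (2 * pi / real N) ^ a))"
    "\<forall>N>0. m dvd N \<longrightarrow> (\<exists>a. y0 = 2 * Re (cis (2 * pi / real N) ^ a))"
    "\<forall>N>0. n dvd N \<longrightarrow> (\<exists>a. z0 = 2 * Re (cis (2 * pi / real N) ^ a))" by blast
  define N where "N = l * m * n"
  have N: "N > 0" "l dvd N" "m dvd N" "n dvd N" using lmn by (auto simp: N_def)
  with ex have "\<exists>a. x0 = 2 * Re (cis (2 * pi / real N) ^ a)"
    "\<exists>b. y0 = 2 * Re (cis (2 * pi / real N) ^ b)" "\<exists>c. z0 = 2 * Re (cis (2 * pi / real N) ^ c)"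
    by blast+
  moreover define g where "g = cis (2 * pi / real N)"
  ultimately obtain a b c where abc: "x0 = 2 * Re (g ^ a)" "y0 = 2 * Re (g ^ b)" "z0 = 2 * Re (g ^ c)"
    by blast
  have g: "g ^ N = 1" using N by (simp add: g_def Complex.DeMoivre)
  define U where "U = int_values g"
  define x y z where "x = (\<lambda>w. 2 * Re (w ^ a))" and "y = (\<lambda>w. 2 * Re (w ^ b))" and "z = (\<lambda>w. 2 * Re (w ^ c))"
  have xyz: "x \<in> U" "y \<in> U" "z \<in> U"
    unfolding x_def y_def z_def U_def using int_values_unity[OF g N(1)] by blast+
  have pg: "(x g, y g, z g) = global_coords A B" using p abc by (simp add: x_def y_def z_def)
  have U: "real_subring U" unfolding U_def by (rule real_subring_int_values)
  define T where "T w = (\<lambda>u. u w) ` {u \<in> U. \<forall>v\<in>conjugates g. \<bar>u v\<bar> \<le> 2}" for w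
  have finT: "finite (T w)" if "w \<in> conjugates g" for w
    unfolding T_def U_def using finite_bounded_int_values[OF g N(1) that] .
  have TI: "u w \<in> T w" if "u \<in> U" "rational_angle (u g)" for u w
    using that rational_angle_conjugates[of u g] unfolding T_def U_def by blast
  have T2: "\<bar>t\<bar> \<le> 2" if "t \<in> T w" "w \<in> conjugates g" for t w using that unfolding T_def by auto
  \<comment> \<open>The same twists applied at \<open>g\<close> give rational angles by assumption,
    so \<open>TI\<close> puts the coordinates at \<open>w\<close> into the set \<open>T w\<close>,
    finite at the conjugates.\<close>
  have orb: "q \<in> T w \<times> T w \<times> T w" if q: "q \<in> Gamma_orbit (x w, y w, z w)" for q w
    using Gamma_orbit_family[OF U xyz q, of g] TI rat unfolding pg by blast
  have kap: "kappa (x w, y w, z w) \<le> 2" if w: "w \<in> conjugates g" for w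
  proof (rule finite_orbit_kappa_le_2)
    have "finite (T w \<times> T w \<times> T w)" using finT[OF w] by simp
    moreover have "Gamma_orbit (x w, y w, z w) \<subseteq> T w \<times> T w \<times> T w" using orb by blast
    ultimately show "finite (Gamma_orbit (x w, y w, z w))" by (rule rev_finite_subset)
    show "\<bar>x'\<bar> \<le> 2 \<and> \<bar>y'\<bar> \<le> 2 \<and> \<bar>z'\<bar> \<le> 2" if "(x', y', z') \<in> Gamma_orbit (x w, y w, z w)" for x' y' z'
      using orb[OF that] T2 w by auto
  qed
  \<comment> \<open>At \<open>g\<close> the given pair itself is kept, since its group is the one
    under study; at the other conjugates any pair with these coordinates serves.\<close>
  have "\<exists>P\<in>SU2. \<exists>Q\<in>SU2. global_coords P Q = (x w, y w, z w) \<and> (w = g \<longrightarrow> P = A \<and> Q = B)"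
    if w: "w \<in> conjugates g" for w
  proof (cases "w = g")
    case True
    then show ?thesis using S pg by auto
  next
    case False
    have "(x w, y w, z w) \<in> T w \<times> T w \<times> T w" by (rule orb) (rule Gamma_orbit.base)
    then have "\<bar>x w\<bar> \<le> 2" "\<bar>y w\<bar> \<le> 2" using T2 w by auto
    from SU2_with_global_coords[OF this kap[OF w]] show ?thesis using False by blast
  qed
  then obtain \<alpha> \<beta> where \<alpha>\<beta>: "\<And>w. w \<in> conjugates g \<Longrightarrow> \<alpha> w \<in> SU2 \<and> \<beta> w \<in> SU2 \<and>
      global_coords (\<alpha> w) (\<beta> w) = (x w, y w, z w) \<and> (w = g \<longrightarrow> \<alpha> w = A \<and> \<beta> w = B)"
    by metis
  have "Re (trace C) \<in> T g" if "C \<in> gen_subgroup A B" for C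
  proof -
    have "C \<in> gen_subgroup (\<alpha> g) (\<beta> g)" using that \<alpha>\<beta>[OF self_conjugate] by simp
    from trace_family[where \<alpha> = \<alpha> and \<beta> = \<beta> and G = "conjugates g", OF U _ _ xyz _ self_conjugate this] \<alpha>\<beta>
    obtain t where t: "t \<in> U" "t g = Re (trace C)" "\<forall>w\<in>conjugates g. \<bar>t w\<bar> \<le> 2" by blast
    from t(1,3) have "t g \<in> T g" unfolding T_def by blast
    then show ?thesis using t(2) by simp
  qed
  from finite_traces_not_dense[OF finT[OF self_conjugate] this] show ?thesis by blast
qed

section \<open>Ellipses and irrational rotations\<close>

text \<open>Replacing \<open>z\<close> by \<open>v = (cos \<theta> * y - z) / sin \<theta>\<close>
  turns the ellipse into the circle of radius \<open>\<bar>R\<bar>\<close>.\<close>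

lemma ellipse_param:
  fixes y z R \<theta> :: real
  assumes s: "sin \<theta> \<noteq> 0" and R: "R\<^sup>2 * (sin \<theta>)\<^sup>2 = y\<^sup>2 + z\<^sup>2 - 2 * cos \<theta> * y * z"
  obtains \<phi> where "y = R * cos \<phi>" "z = R * cos (\<phi> + \<theta>)"
proof -
  define v where "v = (cos \<theta> * y - z) / sin \<theta>"
  have v: "sin \<theta> * v = cos \<theta> * y - z" using s by (simp add: v_def)
  have "(y\<^sup>2 + v\<^sup>2) * (sin \<theta>)\<^sup>2 = y\<^sup>2 * (sin \<theta>)\<^sup>2 + (sin \<theta> * v)\<^sup>2"
    by (simp add: power2_eq_square algebra_simps)
  also have "\<dots> = y\<^sup>2 * ((sin \<theta>)\<^sup>2 + (cos \<theta>)\<^sup>2) + z\<^sup>2 - 2 * cos \<theta> * y * z"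
    unfolding v by algebra
  also have "\<dots> = R\<^sup>2 * (sin \<theta>)\<^sup>2" unfolding R by simp
  finally have yv: "y\<^sup>2 + v\<^sup>2 = R\<^sup>2" using s by simp
  have "\<exists>\<phi>. y = R * cos \<phi> \<and> v = R * sin \<phi>"
  proof (cases "R = 0")
    case True
    then show ?thesis using yv by (simp add: sum_power2_eq_zero_iff)
  next
    case False
    then have "(y / R)\<^sup>2 + (v / R)\<^sup>2 = 1"
      using yv by (simp add: power_divide flip: add_divide_distrib)
    then obtain \<phi> where "y / R = cos \<phi>" "v / R = sin \<phi>" by (rule sincos_total_2pi)
    then show ?thesis using False by (auto simp: field_simps)
  qed
  then obtain \<phi> where \<phi>: "y = R * cos \<phi>" "v = R * sin \<phi>" by blast
  have "z = cos \<theta> * y - sin \<theta> * v" using v by simp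
  then have "z = R * cos (\<phi> + \<theta>)" unfolding \<phi> cos_add by (simp add: algebra_simps)
  then show ?thesis using that \<phi>(1) by blast
qed

lemma ellipse_eq:
  fixes R \<theta> \<phi> :: real
  shows "(R * cos \<phi>)\<^sup>2 + (R * cos (\<phi> + \<theta>))\<^sup>2 - 2 * cos \<theta> * (R * cos \<phi>) * (R * cos (\<phi> + \<theta>)) = R\<^sup>2 * (sin \<theta>)\<^sup>2"
proof -
  have "(R * cos \<phi>)\<^sup>2 + (R * cos (\<phi> + \<theta>))\<^sup>2 - 2 * cos \<theta> * (R * cos \<phi>) * (R * cos (\<phi> + \<theta>))
    = R\<^sup>2 * ((cos \<phi>)\<^sup>2 * (1 - (cos \<theta>)\<^sup>2) + (sin \<phi>)\<^sup>2 * (sin \<theta>)\<^sup>2)"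
    unfolding cos_add by (simp add: power2_eq_square algebra_simps)
  also have "\<dots> = R\<^sup>2 * (sin \<theta>)\<^sup>2 * ((sin \<phi>)\<^sup>2 + (cos \<phi>)\<^sup>2)"
    unfolding cos_squared_eq[of \<theta>] by algebra
  finally show ?thesis by simp
qed

lemma irrational_angleE:
  assumes "\<bar>x\<bar> \<le> 2" "\<not> rational_angle x"
  obtains r where "r \<notin> \<rat>" "x = 2 * cos (2 * pi * r)" "sin (2 * pi * r) \<noteq> 0"
proof -
  define r where "r = arccos (x / 2) / (2 * pi)"
  have x: "x = 2 * cos (2 * pi * r)" using assms(1) by (simp add: r_def abs_le_iff)
  then have r: "r \<notin> \<rat>" using assms(2) by (auto simp: rational_angle_def)
  have "sin (2 * pi * r) \<noteq> 0"
  proof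
    assume "sin (2 * pi * r) = 0"
    then obtain i where "2 * pi * r = of_int i * pi" by (auto simp: sin_zero_iff_int2)
    then have "r = of_int i / 2" by (simp add: field_simps)
    also have "of_int i / 2 \<in> \<rat>" by (intro Rats_divide Rats_of_int Rats_number_of)
    finally show False using r by simp
  qed
  then show ?thesis using that x r by blast
qed

text \<open>On the level set of its first coordinate \<open>2 * cos \<theta>\<close>, \<open>tauX\<close> is conjugate to
  the rotation by \<open>\<theta>\<close>.\<close>

lemma tauX_ellipse:
  assumes C: "closed C" "\<And>p. p \<in> C \<Longrightarrow> tauX p \<in> C"
    and p: "(x, y, z) \<in> C" and x: "\<bar>x\<bar> \<le> 2" "\<not> rational_angle x"
    and eq: "y'\<^sup>2 + z'\<^sup>2 - x * y' * z' = y\<^sup>2 + z\<^sup>2 - x * y * z"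
  shows "(x, y', z') \<in> C"
proof -
  obtain r where r: "r \<notin> \<rat>" and xr: "x = 2 * cos (2 * pi * r)" "sin (2 * pi * r) \<noteq> 0"
    using irrational_angleE[OF x] .
  define \<theta> where "\<theta> = 2 * pi * r"
  note \<theta> = xr[folded \<theta>_def]
  define D where "D = y\<^sup>2 + z\<^sup>2 - x * y * z"
  have "D = (y - cos \<theta> * z)\<^sup>2 + (1 - (cos \<theta>)\<^sup>2) * z\<^sup>2"
    unfolding D_def \<theta>(1) by (simp add: power2_eq_square algebra_simps)
  then have D: "D \<ge> 0" by (simp flip: sin_squared_eq)
  define R where "R = sqrt D / sin \<theta>"
  have R: "R\<^sup>2 * (sin \<theta>)\<^sup>2 = D" using D \<theta>(2) by (simp add: R_def power_divide)
  obtain \<phi> where \<phi>: "y = R * cos \<phi>" "z = R * cos (\<phi> + \<theta>)"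
    by (rule ellipse_param[OF \<theta>(2), of R y z]) (use R D_def \<theta>(1) in auto)
  obtain \<psi> where \<psi>: "y' = R * cos \<psi>" "z' = R * cos (\<psi> + \<theta>)"
    by (rule ellipse_param[OF \<theta>(2), of R y' z']) (use R D_def \<theta>(1) eq in auto)
  \<comment> \<open>\<open>f\<close> runs through the ellipse with period 1, and \<open>tauX\<close>
    advances its argument by the irrational number \<open>r\<close>.\<close>
  define f where "f = (\<lambda>t :: real. (x, R * cos (\<phi> + 2 * pi * t), R * cos (\<phi> + 2 * pi * t + \<theta>)))"
  have shift: "f (t + of_int i) = f t" for t i
  proof -
    have "cos (u + 2 * pi * of_int i) = cos u" for u :: real
      unfolding cos_add cos_int_2pin sin_int_2pin by simp
    from this[of "\<phi> + 2 * pi * t"] this[of "\<phi> + 2 * pi * t + \<theta>"]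
    show ?thesis unfolding f_def by (simp add: algebra_simps)
  qed
  have orbit: "f (real n * r) \<in> C" for n
  proof (induction n)
    case 0
    then show ?case using p \<phi> by (simp add: f_def)
  next
    case (Suc n)
    define u where "u = \<phi> + 2 * pi * (real n * r)"
    have "cos u = cos ((u + \<theta>) - \<theta>)" "cos (u + \<theta> + \<theta>) = cos ((u + \<theta>) + \<theta>)" by simp_all
    then have step: "cos (u + \<theta> + \<theta>) = x * cos (u + \<theta>) - cos u"
      unfolding \<theta>(1) cos_add[of "u + \<theta>"] cos_diff[of "u + \<theta>"] by simp
    then have "tauX (f (real n * r)) = (x, R * cos (u + \<theta>), R * cos (u + \<theta> + \<theta>))"
      unfolding f_def tauX_def u_def[symmetric] step by (simp add: right_diff_distrib)
    also have "\<dots> = f (real (Suc n) * r)"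
      unfolding f_def u_def \<theta>_def by (simp add: algebra_simps)
    finally show ?case using C(2)[OF Suc] by simp
  qed
  have "closed (f -` C)"
    by (intro continuous_closed_vimage C(1)) (auto simp: f_def intro!: continuous_intros)
  moreover have "range (\<lambda>n. frac (real n * r)) \<subseteq> f -` C"
  proof clarsimp
    fix n
    have "f (frac (real n * r)) = f (frac (real n * r) + of_int \<lfloor>real n * r\<rfloor>)" by (rule shift[symmetric])
    then show "f (frac (real n * r)) \<in> C" using orbit[of n] by (simp add: frac_def)
  qed
  ultimately have *: "{0..1} \<subseteq> f -` C"
    using closure_minimal Kronecker_approx_1[OF r] by blast
  define t where "t = (\<psi> - \<phi>) / (2 * pi)"
  have "f (frac t) \<in> C" using * frac_ge_0[of t] frac_lt_1[of t] by (simp add: subset_iff)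
  moreover have "f (frac t) = f t" using shift[of "frac t" "\<lfloor>t\<rfloor>"] by (simp add: frac_def)
  moreover have "f t = (x, y', z')" by (simp add: f_def t_def \<psi>)
  ultimately show ?thesis by simp
qed

text \<open>Exchanging the first two coordinates conjugates \<open>tauY\<close> into
  \<open>tauX\<close>.\<close>

lemma tauY_ellipse:
  assumes C: "closed C" "\<And>p. p \<in> C \<Longrightarrow> tauY p \<in> C"
    and p: "(x, y, z) \<in> C" and y: "\<bar>y\<bar> \<le> 2" "\<not> rational_angle y"
    and eq: "x'\<^sup>2 + z'\<^sup>2 - x' * y * z' = x\<^sup>2 + z\<^sup>2 - x * y * z"
  shows "(x', y, z') \<in> C"
proof -
  define swap where "swap = (\<lambda>p :: real \<times> real \<times> real. (fst (snd p), fst p, snd (snd p)))"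
  have "closed (swap -` C)"
    by (intro continuous_closed_vimage C(1)) (auto simp: swap_def intro!: continuous_intros)
  moreover have "tauX q \<in> swap -` C" if "q \<in> swap -` C" for q
    using C(2)[of "swap q"] that by (cases q) (simp add: swap_def tauX_def tauY_def)
  moreover have "(y, x, z) \<in> swap -` C" using p by (simp add: swap_def)
  moreover have "x'\<^sup>2 + z'\<^sup>2 - y * x' * z' = x\<^sup>2 + z\<^sup>2 - y * x * z" using eq by algebra
  ultimately have "(y, x', z') \<in> swap -` C" using tauX_ellipse[OF _ _ _ y] by blast
  then show ?thesis by (simp add: swap_def)
qed

lemma ellipse_point:
  fixes x y D :: real
  assumes "y\<^sup>2 \<le> D"
  shows "\<exists>z. y\<^sup>2 + z\<^sup>2 - x * y * z = D"
proof -
  have nn: "0 \<le> (x * y)\<^sup>2 / 4 + (D - y\<^sup>2)" using assms by simp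
  define z where "z = x * y / 2 + sqrt ((x * y)\<^sup>2 / 4 + (D - y\<^sup>2))"
  have "(z - x * y / 2)\<^sup>2 = (x * y)\<^sup>2 / 4 + (D - y\<^sup>2)" using nn by (simp add: z_def)
  then have "y\<^sup>2 + z\<^sup>2 - x * y * z = D" by (simp add: power2_eq_square algebra_simps)
  then show ?thesis by blast
qed

text \<open>Rational angles are countable.\<close>

lemma ex_irrational_angle:
  assumes "u < v"
  shows "\<exists>x. u < x \<and> x < v \<and> \<not> rational_angle x"
proof (rule ccontr)
  assume "\<not> ?thesis"
  then have "{u<..<v} \<subseteq> (\<lambda>r. 2 * cos (2 * pi * r)) ` \<rat>" by (auto simp: rational_angle_def)
  then have "countable {u<..<v}" using countable_rat countable_image countable_subset by metis
  then show False using uncountable_open_interval assms by blast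
qed

text \<open>The point \<open>(x, y, z)\<close> is joined to \<open>(a, b, c)\<close> by an \<open>x\<close>-ellipse, a \<open>y\<close>-ellipse at a
  small irrational height \<open>h\<close>, and an \<open>a\<close>-ellipse.\<close>

lemma ellipse_chain:
  assumes C: "closed C" "\<And>p. p \<in> C \<Longrightarrow> tauX p \<in> C" "\<And>p. p \<in> C \<Longrightarrow> tauY p \<in> C"
    and p: "(x, y, z) \<in> C" "\<bar>x\<bar> \<le> 2" "\<not> rational_angle x" "x\<^sup>2 < s" "x\<^sup>2 + y\<^sup>2 + z\<^sup>2 - x * y * z = s"
    and q: "\<bar>a\<bar> \<le> 2" "\<not> rational_angle a" "a\<^sup>2 < s" "a\<^sup>2 + b\<^sup>2 + c\<^sup>2 - a * b * c = s"
  shows "(a, b, c) \<in> C"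
proof -
  \<comment> \<open>Below 2 the height \<open>h\<close> can be written as twice a cosine; below the
    root both the \<open>x\<close>-ellipse and the \<open>a\<close>-ellipse reach height
    \<open>h\<close>.\<close>
  define m where "m = min 2 (sqrt (min (s - x\<^sup>2) (s - a\<^sup>2)))"
  have "0 < m" using p q by (simp add: m_def)
  then obtain h where h: "0 < h" "h < m" "\<not> rational_angle h" using ex_irrational_angle by blast
  have h2: "\<bar>h\<bar> \<le> 2" using h by (simp add: m_def)
  have "h < sqrt (min (s - x\<^sup>2) (s - a\<^sup>2))" using h by (simp add: m_def)
  then have "h\<^sup>2 < min (s - x\<^sup>2) (s - a\<^sup>2)" using h(1) real_less_rsqrt by (metis not_le real_sqrt_le_iff real_sqrt_unique less_imp_le)
  then have hh: "h\<^sup>2 \<le> s - x\<^sup>2" "a\<^sup>2 \<le> s - h\<^sup>2" by simp_all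
  obtain z1 where z1: "h\<^sup>2 + z1\<^sup>2 - x * h * z1 = s - x\<^sup>2" using ellipse_point[OF hh(1)] by blast
  obtain c1 where c1: "a\<^sup>2 + c1\<^sup>2 - h * a * c1 = s - h\<^sup>2" using ellipse_point[OF hh(2)] by blast
  have c1': "a\<^sup>2 + c1\<^sup>2 - a * h * c1 = s - h\<^sup>2" using c1 by (simp add: mult.commute[of h a])
  have 1: "(x, h, z1) \<in> C" by (rule tauX_ellipse[OF C(1,2) p(1-3)]) (use z1 p(5) in auto)
  have "a\<^sup>2 + c1\<^sup>2 - a * h * c1 = x\<^sup>2 + z1\<^sup>2 - x * h * z1" using z1 c1' by linarith
  from tauY_ellipse[OF C(1,3) 1 h2 h(3) this] have 2: "(a, h, c1) \<in> C" by blast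
  have "b\<^sup>2 + c\<^sup>2 - a * b * c = h\<^sup>2 + c1\<^sup>2 - a * h * c1" using c1' q(4) by linarith
  from tauX_ellipse[OF C(1,2) 2 q(1,2) this] show ?thesis by blast
qed

text \<open>\<open>ellipse_chain\<close> reaches the points with irrational first coordinate
  \<open>u\<close> and \<open>u\<^sup>2 < k + 2\<close>; the others are limits of such points. The
  condition on \<open>y\<close> and \<open>z\<close> excludes an ellipse degenerated to a point, and
  \<open>k < 2\<close> keeps first coordinates away from 2 and -2.\<close>

lemma Erel_subset_closed_invariant:
  assumes C: "closed C" "\<And>p. p \<in> C \<Longrightarrow> tauX p \<in> C" "\<And>p. p \<in> C \<Longrightarrow> tauY p \<in> C"
    and p: "(x, y, z) \<in> C" "\<bar>x\<bar> \<le> 2" "\<not> rational_angle x" "kappa (x, y, z) = k" "y \<noteq> 0 \<or> z \<noteq> 0"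
    and k: "k < 2"
  shows "Erel k \<subseteq> C"
proof
  fix q assume "q \<in> Erel k"
  then obtain a b c where q: "q = (a, b, c)" "\<bar>a\<bar> \<le> 2" "kappa (a, b, c) = k"
    by (cases q) (auto simp: Erel_def Echar_def abs_le_iff)
  define s where "s = k + 2"
  have s4: "s < 4" using k by (simp add: s_def)
  have ps: "x\<^sup>2 + y\<^sup>2 + z\<^sup>2 - x * y * z = s" and qs: "a\<^sup>2 + b\<^sup>2 + c\<^sup>2 - a * b * c = s"
    using p q by (auto simp: kappa_def s_def)
  have form: "v\<^sup>2 + w\<^sup>2 - u * v * w = (v - u * w / 2)\<^sup>2 + (1 - (u / 2)\<^sup>2) * w\<^sup>2" for u v w :: real
    by (simp add: power2_eq_square algebra_simps)
  obtain r where r: "x = 2 * cos (2 * pi * r)" "sin (2 * pi * r) \<noteq> 0"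
    using irrational_angleE[OF p(2,3)] by metis
  have "y\<^sup>2 + z\<^sup>2 - x * y * z = (y - x * z / 2)\<^sup>2 + (sin (2 * pi * r))\<^sup>2 * z\<^sup>2"
    unfolding form r(1) sin_squared_eq by simp
  also have "\<dots> > 0"
    using p(5) r(2) by (cases "z = 0") (auto intro: add_nonneg_pos)
  finally have xs: "x\<^sup>2 < s" using ps by simp
  then have s0: "0 < s" using zero_le_power2[of x] by linarith
  have as: "a\<^sup>2 \<le> s"
  proof -
    have "0 \<le> 1 - (a / 2)\<^sup>2" using q(2) by (simp add: abs_square_le_1)
    then have "0 \<le> b\<^sup>2 + c\<^sup>2 - a * b * c" unfolding form by simp
    then show ?thesis using qs by simp
  qed
  define S where "S = {u. u\<^sup>2 \<le> s}"
  define R where "R u = sqrt ((s - u\<^sup>2) / (1 - (u / 2)\<^sup>2))" for u :: real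
  have lt: "(u / 2)\<^sup>2 < 1" if "u \<in> S" for u using that s4 by (simp add: S_def power_divide)
  have R: "(R u)\<^sup>2 * (sin (arccos (u / 2)))\<^sup>2 = s - u\<^sup>2" and ac: "cos (arccos (u / 2)) = u / 2"
    and sn: "sin (arccos (u / 2)) \<noteq> 0" if "u \<in> S" for u
  proof -
    have "\<bar>u / 2\<bar> < 1" using lt[OF that] by (simp add: abs_square_less_1)
    then show c: "cos (arccos (u / 2)) = u / 2" by (simp add: abs_less_iff)
    have "(sin (arccos (u / 2)))\<^sup>2 = 1 - (u / 2)\<^sup>2" unfolding sin_squared_eq c by simp
    then show "(R u)\<^sup>2 * (sin (arccos (u / 2)))\<^sup>2 = s - u\<^sup>2" "sin (arccos (u / 2)) \<noteq> 0"
      using lt[OF that] that by (auto simp: R_def S_def)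
  qed
  have aS: "a \<in> S" using as by (simp add: S_def)
  obtain \<phi> where \<phi>: "b = R a * cos \<phi>" "c = R a * cos (\<phi> + arccos (a / 2))"
    by (rule ellipse_param[OF sn[OF aS], of "R a" b c]) (use R[OF aS] ac[OF aS] qs in auto)
  \<comment> \<open>\<open>F\<close> varies the first coordinate at the fixed phase
    \<open>\<phi>\<close> of \<open>q\<close>. For \<open>u\<close> in \<open>S\<close> it stays on
    the level set, and \<open>F a = q\<close>.\<close>
  define F where "F u = (u, R u * cos \<phi>, R u * cos (\<phi> + arccos (u / 2)))" for u
  define W where "W = {u. u\<^sup>2 < s \<and> \<not> rational_angle u}"
  have FW: "F u \<in> C" if "u \<in> W" for u
  proof -
    have u: "u \<in> S" "u\<^sup>2 < s" "\<not> rational_angle u" using that by (auto simp: W_def S_def)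
    have "\<bar>u / 2\<bar> < 1" using lt[OF u(1)] by (simp add: abs_square_less_1)
    then have "\<bar>u\<bar> \<le> 2" by simp
    moreover have "u\<^sup>2 + (R u * cos \<phi>)\<^sup>2 + (R u * cos (\<phi> + arccos (u / 2)))\<^sup>2
        - u * (R u * cos \<phi>) * (R u * cos (\<phi> + arccos (u / 2))) = s"
      using ellipse_eq[of "R u" \<phi> "arccos (u / 2)"] R[OF u(1)] ac[OF u(1)] by simp
    ultimately show ?thesis unfolding F_def
      by (intro ellipse_chain[OF C p(1-3) xs ps _ u(3,2)])
  qed
  have cont: "continuous_on S F" unfolding F_def R_def
  proof (intro continuous_intros ballI)
    fix u assume "u \<in> S"
    note l = lt[OF this]
    have "1 - (u / 2)\<^sup>2 \<noteq> 0" using l by linarith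
    moreover have "\<bar>u / 2\<bar> < 1" using l by (simp only: abs_square_less_1)
    ultimately    show "1 - (u / 2)\<^sup>2 \<noteq> 0" "1 - (u / 2)\<^sup>2 \<noteq> 0" "- 1 \<le> u / 2 \<and> u / 2 \<le> 1" "(2::real) \<noteq> 0"
      by auto
  qed auto
  \<comment> \<open>The coordinate \<open>a\<close> may be a rational angle or satisfy
    \<open>a\<^sup>2 = s\<close>, so it is approached from \<open>W\<close>.\<close>
  have "a \<in> closure W"
    unfolding closure_approachable
  proof (intro allI impI)
    fix e :: real assume e: "e > 0"
    have aa: "- sqrt s \<le> a" "a \<le> sqrt s" using as real_le_rsqrt[of a s] real_le_rsqrt[of "-a" s] by auto
    have "max (- sqrt s) (a - e) < min (sqrt s) (a + e)" using aa e s0 by auto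
    then obtain u where u: "max (- sqrt s) (a - e) < u" "u < min (sqrt s) (a + e)" "\<not> rational_angle u"
      using ex_irrational_angle by blast
    then have "\<bar>u\<bar> < sqrt s" by auto
    then have "u\<^sup>2 < s" using real_sqrt_less_iff[of "u\<^sup>2" s] by simp
    then show "\<exists>u\<in>W. dist u a < e" using u by (intro bexI[of _ u]) (auto simp: W_def dist_real_def)
  qed
  then obtain g where g: "\<And>n. g n \<in> W" "g \<longlonglongrightarrow> a" by (auto simp: closure_sequential)
  have "\<And>n. g n \<in> S" using g(1) by (auto simp: W_def S_def less_imp_le)
  then have "(\<lambda>n. F (g n)) \<longlonglongrightarrow> F a"
    using cont g(2) aS by (simp add: continuous_on_sequentially comp_def)
  then have "F a \<in> C" using C(1) FW g(1) by (metis closed_sequentially)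
  then show "q \<in> C" using q \<phi> by (simp add: F_def)
qed

section \<open>Lifting the orbit to pairs of generators, and the conclusion\<close>

lemma gen_subgroup_mono:
  assumes "A \<in> gen_subgroup A' B'" "B \<in> gen_subgroup A' B'"
  shows "gen_subgroup A B \<subseteq> gen_subgroup A' B'"
proof
  fix C assume "C \<in> gen_subgroup A B"
  then show "C \<in> gen_subgroup A' B'"
    by induction (use assms in \<open>auto intro: gen_subgroup.intros\<close>)
qed

lemma Re_trace_simps:
  "Re (trace (c *\<^sub>R (M :: cmat2))) = c * Re (trace M)"
  "Re (trace ((M :: cmat2) - N)) = Re (trace M) - Re (trace N)"
  by (simp_all add: trace_def sum_2 algebra_simps)

text \<open>Each twist is realised by a Nielsen move of the pair. The old generators are words in
  the new ones, and this inclusion is enough to pass on density.\<close>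

lemma Gamma_orbit_lift:
  assumes S: "A \<in> SU2" "B \<in> SU2" and q: "q \<in> Gamma_orbit (global_coords A B)"
  shows "\<exists>A'\<in>SU2. \<exists>B'\<in>SU2. q = global_coords A' B' \<and> gen_subgroup A B \<subseteq> gen_subgroup A' B'"
  using q
proof induction
  case base
  then show ?case using S by blast
next
  case (tX q)
  then obtain P Q where *: "P \<in> SU2" "Q \<in> SU2" "q = global_coords P Q" "gen_subgroup A B \<subseteq> gen_subgroup P Q"
    by blast
  have "P ** (P ** Q) = Re (trace P) *\<^sub>R (P ** Q) - Q"
    using SU2_square[OF *(1)] by (simp add: matrix_mul_assoc mat2_distribs)
  then have "tauX q = global_coords P (P ** Q)"
    by (simp add: * global_coords_def tauX_def Re_trace_simps)
  moreover have "gen_subgroup P Q \<subseteq> gen_subgroup P (P ** Q)"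
    using * gen_subgroup.mult[OF gen_subgroup.inv[OF gen_subgroup.genA] gen_subgroup.genB, of P "P ** Q"]
    by (intro gen_subgroup_mono) (auto intro: gen_subgroup.genA)
  ultimately show ?case using * SU2_mult by blast
next
  case (tY q)
  then obtain P Q where *: "P \<in> SU2" "Q \<in> SU2" "q = global_coords P Q" "gen_subgroup A B \<subseteq> gen_subgroup P Q"
    by blast
  have "P ** Q ** Q = Re (trace Q) *\<^sub>R (P ** Q) - P"
    using SU2_square[OF *(2)] by (simp add: mat2_distribs flip: matrix_mul_assoc)
  then have "tauY q = global_coords (P ** Q) Q"
    by (simp add: * global_coords_def tauY_def Re_trace_simps)
  moreover have "gen_subgroup P Q \<subseteq> gen_subgroup (P ** Q) Q"
    using * gen_subgroup.mult[OF gen_subgroup.genA gen_subgroup.inv[OF gen_subgroup.genB], of "P ** Q" Q]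
    by (intro gen_subgroup_mono) (auto intro: gen_subgroup.genB)
  ultimately show ?case using * SU2_mult by blast
next
  case (tXi q)
  then obtain P Q where *: "P \<in> SU2" "Q \<in> SU2" "q = global_coords P Q" "gen_subgroup A B \<subseteq> gen_subgroup P Q"
    by blast
  have "Re (trace (ctrans P ** Q)) = Re (trace P) * Re (trace Q) - Re (trace (P ** Q))"
    using SU2_ctrans_eq[OF *(1)] by (simp add: mat2_distribs Re_trace_simps)
  then have "tauX_inv q = global_coords P (ctrans P ** Q)"
    using * by (simp add: global_coords_def tauX_inv_def)
  moreover have "gen_subgroup P Q \<subseteq> gen_subgroup P (ctrans P ** Q)"
    using * gen_subgroup.mult[OF gen_subgroup.genA gen_subgroup.genB, of P "ctrans P ** Q"]
    by (intro gen_subgroup_mono) (auto intro: gen_subgroup.genA)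
  ultimately show ?case using * SU2_mult SU2_ctrans by blast
next
  case (tYi q)
  then obtain P Q where *: "P \<in> SU2" "Q \<in> SU2" "q = global_coords P Q" "gen_subgroup A B \<subseteq> gen_subgroup P Q"
    by blast
  have "Re (trace (P ** ctrans Q)) = Re (trace Q) * Re (trace P) - Re (trace (P ** Q))"
    using SU2_ctrans_eq[OF *(2)] by (simp add: mat2_distribs Re_trace_simps)
  then have "tauY_inv q = global_coords (P ** ctrans Q) Q"
    using * by (simp add: global_coords_def tauY_inv_def)
  moreover have "gen_subgroup P Q \<subseteq> gen_subgroup (P ** ctrans Q) Q"
    using * gen_subgroup.mult[OF gen_subgroup.genA gen_subgroup.genB, of "P ** ctrans Q" Q]
    by (intro gen_subgroup_mono) (auto intro: gen_subgroup.genB)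
  ultimately show ?case using * SU2_mult SU2_ctrans by blast
qed

lemma continuous_tauX: "continuous_on S tauX" and continuous_tauY: "continuous_on S tauY"
  unfolding tauX_def[abs_def] tauY_def[abs_def] case_prod_beta by (intro continuous_intros)+

theorem theorem2:
  fixes A B :: cmat2 and k :: real
  assumes "A \<in> SU2" and "B \<in> SU2"
    and "SU2 \<subseteq> closure (gen_subgroup A B)"
    and "k = Re (trace (A ** B ** ctrans A ** ctrans B))"
  shows "Erel k \<subseteq> closure (Gamma_orbit (global_coords A B))"
proof -
  define p where "p = global_coords A B"
  have kp: "kappa p = k" using kappa_global_coords[OF assms(1,2)] assms(4) by (simp add: p_def)
  have "A ** B ** ctrans A ** ctrans B \<in> SU2" using assms(1,2) by (intro SU2_mult SU2_ctrans)
  then have "k \<le> 2" using SU2_trace_le assms(4) by fastforce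
  moreover have "k \<noteq> 2" using kappa_2_not_dense[OF assms(1,2)] assms(3) kp by (auto simp: p_def)
  ultimately have k2: "k < 2" by simp
  have lift: "\<exists>P\<in>SU2. \<exists>Q\<in>SU2. q = global_coords P Q \<and> SU2 \<subseteq> closure (gen_subgroup P Q)"
    if q: "q \<in> Gamma_orbit p" for q
    using Gamma_orbit_lift[OF assms(1,2) q[unfolded p_def]] assms(3) closure_mono by blast
  obtain x y z where xyz: "(x, y, z) \<in> Gamma_orbit p"
    and irr: "\<not> (rational_angle x \<and> rational_angle y \<and> rational_angle z)"
    using rational_orbit_not_dense[OF assms(1,2)] assms(3) unfolding p_def by blast
  \<comment> \<open>These two points have first coordinates \<open>y\<close> and \<open>z\<close>,
    so an irrational angle can be brought to the first place.\<close>
  note orb = Gamma_orbit.tY[OF Gamma_orbit.tXi[OF xyz]] Gamma_orbit.tY[OF xyz]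
  have "\<exists>a b c. (a, b, c) \<in> Gamma_orbit p \<and> \<not> rational_angle a"
    using irr xyz orb unfolding tauX_inv_def tauY_def prod.case by blast
  then obtain a b c where abc: "(a, b, c) \<in> Gamma_orbit p" and a: "\<not> rational_angle a" by blast
  obtain P Q where PQ: "P \<in> SU2" "Q \<in> SU2" "(a, b, c) = global_coords P Q"
      "SU2 \<subseteq> closure (gen_subgroup P Q)"
    using lift[OF abc] by blast
  \<comment> \<open>If both vanished, the pair would satisfy the trace conditions of
    \<open>dihedral_not_dense\<close>.\<close>
  have "b \<noteq> 0 \<or> c \<noteq> 0"
    using dihedral_not_dense[OF PQ(1,2)] PQ(3,4) by (auto simp: global_coords_def)
  moreover have "\<bar>a\<bar> \<le> 2" using SU2_trace_le[OF PQ(1)] PQ(3) by (simp add: global_coords_def)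
  moreover have "kappa (a, b, c) = k" using kappa_Gamma_orbit[OF abc] kp by simp
  moreover have "(a, b, c) \<in> closure (Gamma_orbit p)" using abc closure_subset by blast
  moreover have "tauX q \<in> closure (Gamma_orbit p)" "tauY q \<in> closure (Gamma_orbit p)"
    if "q \<in> closure (Gamma_orbit p)" for q
    using image_closure_subset[OF continuous_tauX closed_closure, of "Gamma_orbit p" "Gamma_orbit p"]
      image_closure_subset[OF continuous_tauY closed_closure, of "Gamma_orbit p" "Gamma_orbit p"]
      that closure_subset[of "Gamma_orbit p"] by (blast intro: Gamma_orbit.tX Gamma_orbit.tY)+
  ultimately show ?thesis
    using Erel_subset_closed_invariant[OF closed_closure _ _ _ _ a _ _ k2, of "Gamma_orbit p" b c]
    unfolding p_def by blast
qed

end
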